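(* Let $q$ be a prime power, $n\ge 2$ an integer and $k\le n-1$ a nonnegative integer, and suppose there exist $k$-normal elements in $\mathbb{F}_{q^n}$ over $\mathbb{F}_q$. Then there exists a $k$-normal element of $\mathbb{F}_{q^n}$ whose multiplicative order is at least $$\tau(k,q,n):=4^{(k-n)/q}\cdot q^{\,n-k-\frac{1.1n}{\log\log(q^n-1)}}.$$
   Context: $\log$ denotes the natural logarithm. An element $\alpha\in\mathbb{F}_{q^n}$ is $k$-normal over $\mathbb{F}_q$ if the $\mathbb{F}_q$-vector space spanned by $\alpha,\alpha^q,\dots,\alpha^{q^{n-1}}$ has dimension $n-k$. *)

theory Defs
  imports "HOL-Analysis.Analysis" "HOL-Number_Theory.Number_Theory"
begin

text \<open>The prime subfield-like copy of F_q inside a finite field of order q^n: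
  the set of roots of X^q - X (the unique subfield of order q).\<close>
definition Fq :: "nat \<Rightarrow> ('a::field) set" where
  "Fq q = {x. x ^ q = x}"

definition lin_span :: "('a::field) set \<Rightarrow> 'a set \<Rightarrow> 'a set" where
  "lin_span K S = {(\<Sum>b\<in>B. c b * b) | B c. finite B \<and> B \<subseteq> S \<and> (\<forall>b\<in>B. c b \<in> K)}"

definition lin_indep :: "('a::field) set \<Rightarrow> 'a set \<Rightarrow> bool" where
  "lin_indep K B \<longleftrightarrow> finite B \<and>
     (\<forall>c. (\<forall>b\<in>B. c b \<in> K) \<longrightarrow> (\<Sum>b\<in>B. c b * b) = 0 \<longrightarrow> (\<forall>b\<in>B. c b = 0))"

definition has_dim :: "('a::field) set \<Rightarrow> 'a set \<Rightarrow> nat \<Rightarrow> bool" where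
  "has_dim K V d \<longleftrightarrow> (\<exists>B. B \<subseteq> V \<and> lin_indep K B \<and> lin_span K B = V \<and> card B = d)"

definition k_normal :: "nat \<Rightarrow> nat \<Rightarrow> nat \<Rightarrow> ('a::field) \<Rightarrow> bool" where
  "k_normal q n k \<alpha> \<longleftrightarrow> has_dim (Fq q) (lin_span (Fq q) {\<alpha> ^ (q ^ i) | i. i < n}) (n - k)"

definition mult_ord :: "('a::field) \<Rightarrow> nat" where
  "mult_ord \<alpha> = (LEAST m. m > 0 \<and> \<alpha> ^ m = 1)"

definition tau :: "nat \<Rightarrow> nat \<Rightarrow> nat \<Rightarrow> real" where
  "tau k q n = 4 powr ((real k - real n) / real q) *
     real q powr (real n - real k - 1.1 * real n / ln (ln (real q ^ n - 1)))"

end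

theory Submission
  imports Defs "HOL-Library.Discrete_Functions"
begin

text \<open>
  Put \<open>m = q\<^sup>n - 1\<close> and suppose that every \<open>k\<close>-normal element has order below \<open>\<tau> = \<tau>(k, q, n)\<close>.
  Since at most \<open>\<phi>(d)\<close> elements have order \<open>d\<close>, the number of \<open>k\<close>-normal elements is less than
  \<open>\<tau> \<Sum>\<^bsub>x \<noteq> 0\<^esub> 1 / ord x \<le> \<tau> F(m)\<close>, where \<open>F(m) = \<Sum>\<^bsub>d | m\<^esub> \<phi>(d) / d\<close>. On the other hand, the
  \<open>\<bbbF>\<^sub>q\<close>-span \<open>V\<close> of the conjugates of one \<open>k\<close>-normal element is a cyclic \<open>\<bbbF>\<^sub>q[Frobenius]\<close>-module of
  dimension \<open>n - k\<close>, all generators of \<open>V\<close> are \<open>k\<close>-normal, and there are at least \<open>(q - 1)\<^bsup>n - k\<^esup>\<close> of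
  them: along a chain of submodules of \<open>V\<close>, each refinement from \<open>W\<close> to a maximal submodule \<open>W'\<close>
  costs at most one coset of \<open>W'\<close> in each coset of \<open>W\<close>. As \<open>1 - 1/q \<ge> 4\<^bsup>-1/q\<^esup>\<close>, a contradiction
  follows from \<open>F(m) \<le> m\<^bsup>1.1 / ln ln m\<^esup>\<close>.

  For the latter bound, \<open>F(m)\<close> is the product of \<open>1 + a (1 - 1/p)\<close> over the prime powers \<open>p\<^sup>a\<close>
  exactly dividing \<open>m\<close>, so \<open>F(m) \<le> C\<^sub>j m\<^bsup>1/j\<^esup>\<close> where \<open>C\<^sub>j\<close> is a product over the primes below \<open>2\<^sup>j\<close>,
  and \<open>j\<close> is chosen close to \<open>ln ln m / 0.8\<close>. Working with \<open>F\<close> rather than with the number of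
  divisors of \<open>m\<close>, for which the constant 1.1 is almost sharp, leaves enough room to bound the
  number of primes in \<open>[2\<^sup>i, 2\<^bsup>i+1\<^esup>)\<close> just by the number of residues coprime to 6.
\<close>

subsection \<open>Bounding the sum of \<open>\<phi>(d) / d\<close> by local factors\<close>

text \<open>For a cyclic group of order \<open>m\<close> this is the sum of the reciprocals of all
  element orders.\<close>

definition totient_ratio_sum :: "nat \<Rightarrow> real" where
  "totient_ratio_sum m = (\<Sum>d | d dvd m. real (totient d) / real d)"

lemma totient_ratio_prime_power:
  assumes "prime p"
  shows "(\<Sum>i\<le>a. real (totient (p ^ i)) / real (p ^ i)) = 1 + real a * (1 - 1 / real p)"
proof (induction a)
  case (Suc a)
  have "p > 0" using assms by (simp add: prime_gt_0_nat)
  have "real (totient (p ^ Suc a)) = real p ^ a * (real p - 1)"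
    using assms \<open>p > 0\<close> by (simp add: totient_prime_power_Suc of_nat_diff del: power_Suc)
  hence "real (totient (p ^ Suc a)) / real (p ^ Suc a) = 1 - 1 / real p"
    using \<open>p > 0\<close> by (simp add: field_simps)
  with Suc show ?case by (simp add: distrib_right del: power_Suc)
qed simp

text \<open>Since \<open>p\<close> does not divide \<open>e\<close>, the exponent \<open>i\<close>
  is recovered from \<open>p ^ i * e\<close> as its multiplicity at \<open>p\<close>.\<close>

lemma divisors_prime_power_mult:
  fixes p n :: nat
  assumes p: "prime p" and n: "\<not> p dvd n"
  shows "bij_betw (\<lambda>(i, e). p ^ i * e) ({..a} \<times> {e. e dvd n}) {d. d dvd p ^ a * n}"
  unfolding bij_betw_def
proof (intro conjI)
  have ndvd: "\<not> p dvd e" if "e dvd n" for e using that n dvd_trans by blast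
  have n0: "n \<noteq> 0" using n by (metis dvd_0_right)
  show "inj_on (\<lambda>(i, e). p ^ i * e) ({..a} \<times> {e. e dvd n})"
  proof (rule inj_onI, clarsimp)
    fix i e i' e' assume *: "e dvd n" "e' dvd n" "p ^ i * e = p ^ i' * e'"
    have "e \<noteq> 0" "e' \<noteq> 0" using * n0 by auto
    then have "multiplicity p (p ^ i * e) = i" "multiplicity p (p ^ i' * e') = i'"
      using p ndvd[OF *(1)] ndvd[OF *(2)]
      by (simp_all add: prime_elem_multiplicity_mult_distrib not_dvd_imp_multiplicity_0)
    with * p show "i = i' \<and> e = e'" by (auto simp: prime_gt_0_nat)
  qed
  show "(\<lambda>(i, e). p ^ i * e) ` ({..a} \<times> {e. e dvd n}) = {d. d dvd p ^ a * n}"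
  proof (intro equalityI subsetI)
    fix d assume "d \<in> {d. d dvd p ^ a * n}"
    then obtain b c where "d = b * c" "b dvd p ^ a" "c dvd n"
      by (auto elim: dvd_productE)
    then show "d \<in> (\<lambda>(i, e). p ^ i * e) ` ({..a} \<times> {e. e dvd n})"
      using divides_primepow_nat[OF p] by force
  qed (auto intro: mult_dvd_mono le_imp_power_dvd)
qed

lemma totient_ratio_sum_prime_power_mult:
  assumes p: "prime p" and n: "\<not> p dvd n"
  shows "totient_ratio_sum (p ^ a * n) = (1 + real a * (1 - 1 / real p)) * totient_ratio_sum n"
proof -
  have cop: "coprime (p ^ i) e" if "e dvd n" for i e
    using p n that by (meson coprime_power_left_iff dvd_trans prime_imp_coprime)
  have "totient_ratio_sum (p ^ a * n) =
      (\<Sum>(i, e)\<in>{..a} \<times> {e. e dvd n}. real (totient (p ^ i * e)) / real (p ^ i * e))"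
    unfolding totient_ratio_sum_def
    by (subst sum.reindex_bij_betw[OF divisors_prime_power_mult[OF p n, of a], symmetric])
      (simp add: case_prod_unfold)
  also have "\<dots> = (\<Sum>(i, e)\<in>{..a} \<times> {e. e dvd n}.
      real (totient (p ^ i)) / real (p ^ i) * (real (totient e) / real e))"
    using cop by (intro sum.cong) (auto simp: totient_mult_coprime)
  also have "\<dots> = (\<Sum>i\<le>a. real (totient (p ^ i)) / real (p ^ i)) * totient_ratio_sum n"
    unfolding totient_ratio_sum_def by (simp add: sum_product sum.cartesian_product)
  finally show ?thesis using totient_ratio_prime_power[OF p] by simp
qed

text \<open>The full power of one prime is split off at a time; \<open>C p\<close> absorbs the
  excess of its local factor over the \<open>\<epsilon>\<close>-th power of that prime
  power.\<close>

lemma totient_ratio_sum_le_prime_factors: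
  fixes C :: "nat \<Rightarrow> real"
  assumes C: "\<And>p a. prime p \<Longrightarrow> 1 + real a * (1 - 1 / real p) \<le> C p * real p powr (\<epsilon> * real a)"
    and "m > 0"
  shows "totient_ratio_sum m \<le> (\<Prod>p\<in>prime_factors m. C p) * real m powr \<epsilon>"
  using \<open>m > 0\<close>
proof (induction m rule: less_induct)
  case (less m)
  show ?case
  proof (cases "m = 1")
    case True
    then show ?thesis by (simp add: totient_ratio_sum_def)
  next
    case False
    then obtain p where p: "prime p" "p dvd m" using prime_factor_nat by blast
    define a where "a = multiplicity p m"
    obtain n where n: "m = p ^ a * n" "\<not> p dvd n"
      using multiplicity_decompose'[of m p] p less.prems not_prime_unit a_def by blast
    have "n > 0" using n less.prems by (cases n) auto
    have a: "a > 0" using p less.prems by (simp add: a_def prime_multiplicity_gt_zero_iff)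
    have p1: "p > 1" using p(1) by (rule prime_gt_1_nat)
    have "n < m" using n \<open>n > 0\<close> one_less_power[OF p1 a] by simp
    then have IH: "totient_ratio_sum n \<le> (\<Prod>p\<in>prime_factors n. C p) * real n powr \<epsilon>"
      using less.IH \<open>n > 0\<close> by blast
    have pf: "prime_factors m = insert p (prime_factors n)" "p \<notin> prime_factors n"
      using n p a \<open>n > 0\<close> by (auto simp: prime_factors_product prime_factors_power prime_prime_factors)
    have "totient_ratio_sum n \<ge> 0" unfolding totient_ratio_sum_def by (intro sum_nonneg) auto
    moreover have "0 \<le> 1 + real a * (1 - 1 / real p)" using p1 by simp
    ultimately have "totient_ratio_sum m \<le> (C p * real p powr (\<epsilon> * real a)) *
        ((\<Prod>p\<in>prime_factors n. C p) * real n powr \<epsilon>)"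
      unfolding n(1) totient_ratio_sum_prime_power_mult[OF p(1) n(2)]
      using C[OF p(1), of a] IH by (intro mult_mono) auto
    also have "\<dots> = (\<Prod>p\<in>prime_factors m. C p) * real m powr \<epsilon>"
      using pf p1 \<open>n > 0\<close> by (simp add: n(1) powr_mult powr_powr powr_realpow[symmetric] mult_ac)
    finally show ?thesis .
  qed
qed

text \<open>This makes the constant independent of \<open>m\<close>: primes outside \<open>P\<close>
  contribute 1, and members of \<open>P\<close> not dividing \<open>m\<close> only enlarge the
  product.\<close>

lemma totient_ratio_sum_le:
  fixes C :: "nat \<Rightarrow> real"
  assumes C: "\<And>p a. prime p \<Longrightarrow> 1 + real a * (1 - 1 / real p) \<le> C p * real p powr (\<epsilon> * real a)"
    and P: "finite P" "\<And>p. prime p \<Longrightarrow> p \<notin> P \<Longrightarrow> C p = 1" "\<And>p. p \<in> P \<Longrightarrow> C p \<ge> 1"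
    and m: "m > 0"
  shows "totient_ratio_sum m \<le> (\<Prod>p\<in>P. C p) * real m powr \<epsilon>"
proof -
  have "(\<Prod>p\<in>prime_factors m. C p) = (\<Prod>p\<in>prime_factors m \<inter> P. C p)"
    using P by (intro prod.mono_neutral_right) auto
  also have "\<dots> \<le> (\<Prod>p\<in>P. C p)"
  proof (rule prod_mono2)
    show "C b \<ge> 0" if "b \<in> prime_factors m \<inter> P" for b
      using P(3)[of b] that by simp
  qed (use P in auto)
  finally show ?thesis
    using totient_ratio_sum_le_prime_factors[of C \<epsilon>, OF C m] 
    by (meson mult_right_mono order_trans powr_ge_zero)
qed

subsection \<open>The exponents \<open>1 / j\<close>\<close>

text \<open>The function \<open>a \<mapsto> (1 + a b) q\<^sup>-\<^sup>a\<close> is maximal at \<open>a = r\<close>.\<close>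
lemma affine_le_power_mult:
  fixes b q :: real and r a :: nat
  assumes b: "b \<ge> 0" and q: "q \<ge> 1"
    and lower: "1 + (real r + 1) * b \<le> (1 + real r * b) * q"
    and upper: "r > 0 \<Longrightarrow> (1 + (real r - 1) * b) * q \<le> 1 + real r * b"
  shows "(1 + real a * b) * q ^ r \<le> (1 + real r * b) * q ^ a"
proof (cases "a \<ge> r")
  case True
  \<comment> \<open>The ratio of consecutive values of \<open>1 + a * b\<close> falls as
    \<open>a\<close> grows, so the bound \<open>q\<close> on it at \<open>a = r\<close> propagates
    upwards.\<close>
  have "1 + real (r + n) * b \<le> (1 + real r * b) * q ^ n" for n
  proof (induction n)
    case (Suc n)
    have "b \<le> (1 + real r * b) * (q - 1)" using lower by (simp add: algebra_simps)
    also have "\<dots> \<le> (1 + real (r + n) * b) * (q - 1)"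
      using b q by (intro mult_right_mono) (auto simp: algebra_simps)
    finally have "1 + real (r + Suc n) * b \<le> (1 + real (r + n) * b) * q"
      by (simp add: algebra_simps)
    also have "\<dots> \<le> ((1 + real r * b) * q ^ n) * q"
      using Suc q by (intro mult_right_mono) auto
    finally show ?case by (simp add: mult_ac)
  qed simp
  from this[of "a - r"] True
  have "(1 + real a * b) * q ^ r \<le> (1 + real r * b) * q ^ (a - r) * q ^ r"
    using q by (intro mult_right_mono) (auto simp: of_nat_diff)
  also have "\<dots> = (1 + real r * b) * q ^ a"
    using True by (simp add: mult.assoc flip: power_add)
  finally show ?thesis .
next
  case False
  \<comment> \<open>Below \<open>r\<close> the same ratio is at least \<open>q\<close>, because it
    is so at the last step, from \<open>r - 1\<close> to \<open>r\<close>.\<close>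
  have "(1 + (real r - real n) * b) * q ^ n \<le> 1 + real r * b" if "n \<le> r" for n
    using that
  proof (induction n)
    case (Suc n)
    have "(1 + (real r - real (Suc n)) * b) * (q - 1) \<le> (1 + (real r - 1) * b) * (q - 1)"
      using b q by (intro mult_right_mono) (auto simp: algebra_simps)
    also have "\<dots> \<le> b" using upper Suc.prems by (simp add: algebra_simps)
    finally have "(1 + (real r - real (Suc n)) * b) * q \<le> 1 + (real r - real n) * b"
      by (simp add: algebra_simps)
    then have "(1 + (real r - real (Suc n)) * b) * q * q ^ n \<le> (1 + (real r - real n) * b) * q ^ n"
      using q by (intro mult_right_mono) auto
    then show ?case using Suc by (simp add: mult_ac)
  qed simp
  from this[of "r - a"] False
  have "(1 + real a * b) * q ^ (r - a) * q ^ a \<le> (1 + real r * b) * q ^ a"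
    using q by (intro mult_right_mono) (auto simp: of_nat_diff)
  moreover have "(1 + real a * b) * q ^ (r - a) * q ^ a = (1 + real a * b) * q ^ r"
    using False by (simp add: mult.assoc flip: power_add)
  ultimately show ?thesis by simp
qed

text \<open>The hypotheses are \<open>j\<close>-th powers of the inequalities wanted for
  \<open>Q powr (1 / j)\<close>. No root occurs in them, so for rational data they are settled by
  exact arithmetic.\<close>

lemma affine_le_powr_root:
  fixes b Q C :: real and r a j :: nat
  assumes b: "b \<ge> 0" and Q: "Q \<ge> 1" and j: "j > 0" and C: "C > 0"
    and lower: "(1 + (real r + 1) * b) ^ j \<le> (1 + real r * b) ^ j * Q"
    and upper: "r > 0 \<Longrightarrow> (1 + (real r - 1) * b) ^ j * Q \<le> (1 + real r * b) ^ j"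
    and const: "(1 + real r * b) ^ j \<le> C ^ j * Q ^ r"
  shows "1 + real a * b \<le> C * Q powr (real a / real j)"
proof -
  define q where "q = Q powr (1 / real j)"
  have q1: "q \<ge> 1" unfolding q_def using Q by (simp add: ge_one_powr_ge_zero)
  have qj: "Q = q ^ j" using Q j by (simp add: q_def powr_realpow[symmetric] powr_powr)
  have "(1 + real a * b) * q ^ r \<le> (1 + real r * b) * q ^ a"
  proof (rule affine_le_power_mult[OF b q1])
    show "1 + (real r + 1) * b \<le> (1 + real r * b) * q"
      by (subst power_mono_iff[OF _ _ j, symmetric])
        (use lower b q1 in \<open>simp_all add: power_mult_distrib flip: qj\<close>)
    show "(1 + (real r - 1) * b) * q \<le> 1 + real r * b" if "r > 0"
      by (subst power_mono_iff[OF _ _ j, symmetric])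
        (use upper that b q1 in \<open>simp_all add: power_mult_distrib flip: qj\<close>)
  qed
  also have "\<dots> \<le> (C * q ^ r) * q ^ a"
  proof (rule mult_right_mono)
    show "1 + real r * b \<le> C * q ^ r"
    proof (subst power_mono_iff[OF _ _ j, symmetric])
      have "Q ^ r = (q ^ r) ^ j" by (simp add: qj mult.commute flip: power_mult)
      with const show "(1 + real r * b) ^ j \<le> (C * q ^ r) ^ j" by (simp add: power_mult_distrib)
    qed (use C b q1 in auto)
  qed (use q1 in auto)
  finally have "1 + real a * b \<le> C * q ^ a" using q1 by (simp add: mult_ac)
  also have "q ^ a = Q powr (real a / real j)"
    using Q by (simp add: q_def powr_realpow[symmetric] powr_powr)
  finally show ?thesis .
qed

text \<open>A triple \<open>(p, r, c)\<close> in the table records that \<open>(1 + a (1 - 1/p)) p\<^bsup>-a/5\<^esup>\<close> is maximal at \<open>a = r\<close>,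
  with maximum at most \<open>c / 1000\<close>.\<close>
lemma totient_ratio_sum_le_fifth_root:
  assumes "m > 0"
  shows "totient_ratio_sum m \<le> 8 * real m powr (1 / 5)"
proof -
  define A :: "(nat \<times> nat \<times> nat) list" where "A = [(2, 5, 1750), (3, 3, 1552), (5, 2, 1366),
    (7, 1, 1259), (11, 1, 1182), (13, 1, 1152), (17, 1, 1102), (19, 1, 1081), (23, 1, 1046),
    (29, 1, 1003), (31, 0, 1000)]"
  define P where "P = fst ` set A"
  define C where "C = (\<lambda>p. case map_of A p of Some rc \<Rightarrow> real (snd rc) / 1000 | None \<Rightarrow> 1)"
  \<comment> \<open>The bound is \<open>2 ^ 5\<close>: for larger \<open>p\<close> the factor
    \<open>2 - 1/p\<close> at \<open>a = 1\<close> is at most the fifth root of \<open>p\<close>, so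
    the maximum is 1, at \<open>a = 0\<close>.\<close>
  have small: "p \<in> P" if "prime p" "p < 32" for p :: nat
  proof (rule ccontr)
    assume "p \<notin> P"
    \<comment> \<open>Apart from 0 and 1, all these numbers are multiples of 2, 3 or 5.\<close>
    with that(2) have "p \<in> {0,1,4,6,8,9,10,12,14,15,16,18,20,21,22,24,25,26,27,28,30}"
      unfolding P_def A_def by (simp; presburger)
    moreover have "\<not> 2 dvd p" "\<not> 3 dvd p" "\<not> 5 dvd p" "p \<noteq> 1" "p \<noteq> 0"
      using that(1) \<open>p \<notin> P\<close> primes_dvd_imp_eq[of 2 p] primes_dvd_imp_eq[of 3 p] primes_dvd_imp_eq[of 5 p]
      by (auto simp: P_def A_def)
    ultimately show False by auto
  qed
  have "totient_ratio_sum m \<le> (\<Prod>p\<in>P. C p) * real m powr (1 / 5)"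
  proof (rule totient_ratio_sum_le)
    fix p a :: nat assume p: "prime p"
    show "1 + real a * (1 - 1 / real p) \<le> C p * real p powr (1 / 5 * real a)"
    proof (cases "p < 32")
      case True
      from small[OF p True] obtain r c where rc: "(p, r, c) \<in> set A" by (auto simp: P_def)
      have "map_of A p = Some (r, c)"
        using rc by (intro map_of_is_SomeI) (auto simp: A_def)
      then have "C p = real c / 1000" by (simp add: C_def)
      have "1 + real a * (1 - 1 / real p) \<le> real c / 1000 * real p powr (real a / real 5)"
        by (rule affine_le_powr_root[where r = r])
          (use rc in \<open>auto simp: A_def power_divide\<close>)
      then show ?thesis unfolding \<open>C p = real c / 1000\<close> by simp
    next
      case False
      then have "C p = 1" by (auto simp: C_def A_def)
      have "(1 + (1 - 1 / real p)) ^ 5 \<le> 2 ^ 5" using False by (intro power_mono) (auto simp: field_simps)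
      also have "\<dots> \<le> real p" using False by simp
      finally have "1 + real a * (1 - 1 / real p) \<le> 1 * real p powr (real a / real 5)"
        by (intro affine_le_powr_root[where r = 0]) (use False in auto)
      then show ?thesis using \<open>C p = 1\<close> by simp
    qed
  next
    show "C p = 1" if "prime p" "p \<notin> P" for p
      using that by (auto simp: C_def P_def split: option.splits dest!: map_of_SomeD)
         (metis fst_conv image_eqI)
    show "C p \<ge> 1" if "p \<in> P" for p
      using that by (auto simp: C_def P_def A_def)
  qed (use assms in \<open>auto simp: P_def\<close>)
  also have "(\<Prod>p\<in>P. C p) \<le> 8" by (simp add: C_def P_def A_def)
  finally show ?thesis by (simp add: mult_right_mono)
qed

section \<open>Exponents \<open>1 / j\<close> with \<open>j >= 7\<close>, via dyadic blocks of
  primes\<close>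

lemma two_powr_ge_affine:
  fixes s :: real
  assumes "s \<ge> 0"
  shows "11 / 8 * s + 3 / 5 \<le> 2 powr s"
proof -
  have l: "11 / 16 \<le> ln (2::real)" "ln (2::real) \<le> 7 / 10"
    using ln_approx_bounds[of 2 3] by (simp_all add: eval_nat_numeral)
  \<comment> \<open>The tangent of \<open>2 powr s\<close> at \<open>s = 1\<close>; the bounds
    \<open>11/16\<close> and \<open>7/10\<close> for \<open>ln 2\<close> then give slope
    \<open>11/8\<close> and intercept \<open>3/5\<close>.\<close>
  have "2 * (1 + (s - 1) * ln 2) \<le> 2 * exp ((s - 1) * ln 2)"
    using exp_ge_add_one_self by (intro mult_left_mono) auto
  also have "\<dots> = 2 powr s"
    by (simp add: powr_def left_diff_distrib exp_diff)
  finally show ?thesis using l mult_right_mono[OF l(1) assms] by (simp add: algebra_simps)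
qed

text \<open>For \<open>i >= 1\<close> an upper bound for the number of primes in
  \<open>[2^i, 2^(i+1))\<close>. At \<open>i = 3\<close> it is 3 although there are only two such
  primes, so that the value at most doubles at each step, also from 3 to 4.\<close>

definition dyadic_count :: "nat \<Rightarrow> nat" where
  "dyadic_count i = (if i \<le> 2 then 2 else 3 * 2 ^ (i - 3))"

lemma dyadic_count_simps:
  "dyadic_count (Suc 0) = 2" "dyadic_count 1 = 2" "dyadic_count 2 = 2" "dyadic_count (Suc (Suc 0)) = 2"
  "dyadic_count (Suc (Suc (Suc i))) = 3 * 2 ^ i"
  by (auto simp: dyadic_count_def)

lemma dyadic_count_Suc_le: "dyadic_count (Suc i) \<le> 2 * dyadic_count i"
proof (cases "i \<le> 2")
  case True
  then show ?thesis by (auto simp: dyadic_count_def)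
next
  case False
  then have "Suc i - 3 = Suc (i - 3)" by simp
  then show ?thesis using False by (simp add: dyadic_count_def)
qed

text \<open>A prime \<open>p > 3\<close> is \<open>\<plusminus>1\<close> modulo 6, hence determined by \<open>p div 3\<close>.\<close>
lemma card_primes_dyadic_le:
  assumes "i \<ge> 2"
  shows "card {p::nat. prime p \<and> 2 ^ i \<le> p \<and> p < 2 ^ Suc i} \<le> dyadic_count i" (is "card ?S \<le> _")
proof -
  have res: "\<not> 2 dvd p" "\<not> 3 dvd p" "p > 3" if "p \<in> ?S" for p
  proof -
    have "(2::nat) ^ 2 \<le> 2 ^ i" using assms by (intro power_increasing) auto
    then show "p > 3" using that by simp
    then show "\<not> 2 dvd p" "\<not> 3 dvd p"
      using that primes_dvd_imp_eq[of 2 p] primes_dvd_imp_eq[of 3 p] by auto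
  qed
  consider "i = 2" | "i = 3" | "i \<ge> 4" using assms by linarith
  then show ?thesis
  proof cases
    case 1
    have "?S \<subseteq> {5, 7}"
    proof
      fix p assume p: "p \<in> ?S"
      then have "p \<in> {4, 5, 6, 7}" using 1 by auto
      with res[OF p] show "p \<in> {5, 7}" by auto
    qed
    from card_mono[OF _ this] show ?thesis using 1 by (simp add: dyadic_count_simps)
  next
    case 2
    have "?S \<subseteq> {11, 13}"
    proof
      fix p assume p: "p \<in> ?S"
      then have "p \<in> {8, 9, 10, 11, 12, 13, 14, 15}" using 2 by auto
      with res[OF p] show "p \<in> {11, 13}" by auto
    qed
    from card_mono[OF _ this] show ?thesis using 2 by (simp add: dyadic_count_def)
  next
    case 3
    define N :: nat where "N = 2 ^ (i - 3)"
    have N: "2 ^ i = 8 * N"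
      using 3 power_add[of "2::nat" 3 "i - 3"] by (simp add: N_def)
    have "(2::nat) ^ 1 \<le> N" unfolding N_def using 3 by (intro power_increasing) auto
    then have N2: "N \<ge> 2" by simp
    have inj: "inj_on (\<lambda>p. p div 3) ?S"
    proof (rule inj_onI)
      fix p p' assume p: "p \<in> ?S" "p' \<in> ?S" and eq: "p div 3 = p' div 3"
      \<comment> \<open>As \<open>x\<close> is odd and no multiple of 3, the parity of
        \<open>x div 3\<close> fixes the remainder.\<close>
      have "x = 3 * (x div 3) + (if even (x div 3) then 1 else 2)" if "x \<in> ?S" for x
        using res(1,2)[OF that] by presburger
      from this[OF p(1)] this[OF p(2)] show "p = p'" unfolding eq by simp
    qed
    have "(\<lambda>p. p div 3) ` ?S \<subseteq> {(8 * N) div 3..(16 * N - 1) div 3}"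
      using N by (auto intro!: div_le_mono)
    from card_mono[OF _ this] have "card ?S \<le> Suc ((16 * N - 1) div 3) - (8 * N) div 3"
      using card_image[OF inj] by simp
    \<comment> \<open>The count is at most \<open>(8 * N + 4) / 3\<close>, whose integer part is at
      most \<open>3 * N\<close> from \<open>N = 2\<close> on. For \<open>N = 1\<close> it would be
      4, hence the separate case \<open>i = 3\<close>.\<close>
    also have "\<dots> \<le> 3 * N"
    proof -
      have "3 * ((16 * N - 1) div 3) \<le> 16 * N - 1" "8 * N \<le> 3 * (8 * N div 3) + 2"
        using div_times_less_eq_dividend[of "16 * N - 1" 3] by linarith+
      then show ?thesis using N2 by linarith
    qed
    finally show ?thesis using 3 by (simp add: dyadic_count_def N_def)
  qed
qed

text \<open>The left side is 7 times the weighted sum for \<open>j = 7\<close>, and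
  \<open>91 / 7 = 13\<close> is below \<open>0.105 * 2^7 - 0.3 = 13.14\<close>. The fraction
  \<open>106/39\<close> is a continued fraction convergent of \<open>exp 1\<close> from below, close
  enough to survive the 91st power.\<close>

lemma ln_dyadic_base_le: "ln (2 ^ 8 * 35 ^ 14 * 3 ^ 63 / 11 ^ 14) \<le> (91 :: real)"
proof -
  have e: "exp (1::real) \<ge> 106 / 39"
    using abs_le_D2[OF e_approx_32] by simp
  have "(2 ^ 8 * 35 ^ 14 * 3 ^ 63) * 39 ^ 91 \<le> 106 ^ 91 * (11 ^ 14 :: real)"
    by simp
  then have "2 ^ 8 * 35 ^ 14 * 3 ^ 63 / 11 ^ 14 \<le> (106 ^ 91 / 39 ^ 91 :: real)"
    by (simp only: divide_le_eq le_divide_eq zero_less_power zero_less_numeral if_True times_divide_eq_left)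
  also have "\<dots> = (106 / 39) ^ 91" by (rule power_divide[symmetric])
  also have "\<dots> \<le> exp 1 ^ 91" by (intro power_mono e) auto
  also have "\<dots> = exp (91::real)" by (simp flip: exp_of_nat_mult)
  finally have "ln (2 ^ 8 * 35 ^ 14 * 3 ^ 63 / 11 ^ 14) \<le> ln (exp (91::real))"
    by (subst ln_le_cancel_iff) auto
  then show ?thesis by (simp only: ln_exp)
qed

text \<open>For primes in \<open>[2\<^sup>i, 2\<^bsup>i+1\<^esup>)\<close> the local factor is at most \<open>exp (g i)\<close>. Passing from \<open>j\<close> to \<open>j + 1\<close>,
  the weights are shifted by one place, because \<open>i / j \<le> (i + 1) / (j + 1)\<close>; the weighted sum then
  essentially doubles, like \<open>2\<^sup>j\<close>.\<close>
lemma dyadic_weights: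
  assumes "j \<ge> 7"
  shows "\<exists>g :: nat \<Rightarrow> real. g 1 = ln (8 * real j / 11) \<and>
    (\<forall>i\<in>{1..<j}. \<forall>a::nat. 1 + real a \<le> exp (g i) * 2 powr (real a * real i / real j)) \<and>
    (\<Sum>i=1..<j. real (dyadic_count i) * g i) \<le> 0.105 * 2 ^ j - 0.3"
  using assms
proof (induction j rule: nat_induct_at_least)
  \<comment> \<open>The block of 2 and 3 gets a weight from the affine bound on
    \<open>2 powr s\<close>, valid for all \<open>j\<close> at once and growing only like
    \<open>ln j\<close>.\<close>
  have first: "1 + real a \<le> exp (ln (8 * real j / 11)) * 2 powr (real a * real 1 / real j)"
    if "j \<ge> 7" for a j :: nat
  proof -
    have "1 + real a \<le> 8 * real j / 11 * (11 / 8 * (real a / real j) + 3 / 5)"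
      using that by (simp add: field_simps)
    also have "\<dots> \<le> 8 * real j / 11 * 2 powr (real a / real j)"
      by (intro mult_left_mono two_powr_ge_affine) auto
    finally show ?thesis using that by simp
  qed
  {
    case base
    \<comment> \<open>\<open>R i\<close> is the \<open>a\<close> at which
      \<open>(1 + a) * 2 powr (- a * i / 7)\<close> is largest; \<open>g i\<close> is the logarithm
      of that maximum.\<close>
    define R where "R = (\<lambda>i::nat. if i = 2 then 4 else if i \<le> 4 then 2 else (1::nat))"
    define g where "g = (\<lambda>i. if i = 1 then ln (8 * real 7 / 11)
      else ln (real (R i) + 1) - real (R i * i) / 7 * ln 2)"
    have "1 + real a \<le> exp (g i) * 2 powr (real a * real i / real 7)" if i: "i \<in> {1..<7}" for i a
    proof (cases "i = 1")
      case True
      then show ?thesis using first[of 7 a] by (simp add: g_def)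
    next
      case False
      with i have "i = 2 \<or> i = 3 \<or> i = 4 \<or> i = 5 \<or> i = 6" by auto
      then have "(real (R i) + 2) ^ 7 \<le> (real (R i) + 1) ^ 7 * 2 ^ i"
          "real (R i) ^ 7 * 2 ^ i \<le> (real (R i) + 1) ^ 7"
        by (auto simp: R_def)
      moreover have "g i = ln (real (R i) + 1) + (- real (R i * i) / 7) * ln 2"
        using False by (simp add: g_def)
      then have eg: "exp (g i) = (real (R i) + 1) * 2 powr (- real (R i * i) / 7)"
        by (simp only: exp_add powr_def) (simp add: add_nonneg_pos)
      have "exp (g i) ^ 7 = (real (R i) + 1) ^ 7 * 2 powr (- real (R i * i))"
        unfolding eg power_mult_distrib by (simp add: powr_power)
      then have "exp (g i) ^ 7 * (2 ^ i) ^ R i = (real (R i) + 1) ^ 7"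
        by (simp only: powr_minus powr_realpow zero_less_numeral) (simp add: mult.commute flip: power_mult)
      ultimately have "1 + real a * 1 \<le> exp (g i) * (2 ^ i) powr (real a / real 7)"
        by (intro affine_le_powr_root[where r = "R i"]) (auto simp: add_ac)
      then show ?thesis by (simp add: powr_powr mult_ac flip: powr_realpow)
    qed
    moreover have "7 * (\<Sum>i=1..<7. real (dyadic_count i) * g i) =
        ln (2 ^ 8 * 35 ^ 14 * 3 ^ 63 / 11 ^ 14)"
    proof -
      have l35: "ln (35::real) = ln 5 + ln 7" using ln_mult[of 5 "7::real"] by simp
      have l56: "ln (56::real) = 3 * ln 2 + ln 7"
        using ln_mult[of "2 ^ 3" "7::real"] ln_realpow[of "2::real" 3] by simp
      have sum7: "(\<Sum>i=1..<7. real (dyadic_count i) * g i) =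
        2 * g 1 + 2 * g 2 + 3 * g 3 + 6 * g 4 + 12 * g 5 + 24 * g 6"
        by (simp add: numeral_eq_Suc sum.atLeast_Suc_lessThan dyadic_count_simps)
      have "ln (a ^ 8 * b ^ 14 * c ^ 63 / d ^ 14) = 8 * ln a + 14 * ln b + 63 * ln c - 14 * ln d"
        if "a > 0" "b > 0" "c > 0" "d > 0" for a b c d :: real
        using that by (simp add: ln_mult ln_div ln_realpow)
      from this[of 2 35 3 11] have lnX: "ln (2 ^ 8 * 35 ^ 14 * 3 ^ 63 / 11 ^ 14 :: real) =
          8 * ln 2 + 14 * ln 35 + 63 * ln 3 - 14 * ln 11" by (simp del: power_numeral)
      show ?thesis
        unfolding sum7 lnX using l35 l56 by (simp add: g_def R_def ln_mult ln_div ln_realpow algebra_simps)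
    qed
    with ln_dyadic_base_le have "(\<Sum>i=1..<7. real (dyadic_count i) * g i) \<le> 0.105 * 2 ^ 7 - 0.3"
      by simp
    ultimately show ?case
      by (intro exI[of _ g]) (simp add: g_def)
  next
    case (Suc j)
    then obtain g where g: "g 1 = ln (8 * real j / 11)"
      "\<And>i a. i \<in> {1..<j} \<Longrightarrow> 1 + real a \<le> exp (g i) * 2 powr (real a * real i / real j)"
      "(\<Sum>i=1..<j. real (dyadic_count i) * g i) \<le> 0.105 * 2 ^ j - 0.3" by blast
    have g0: "g i \<ge> 0" if "i \<in> {1..<j}" for i
      using g(2)[OF that, of 0] by simp
    define g' where "g' = (\<lambda>i. if i = 1 then ln (8 * real (Suc j) / 11) else g (i - 1))"
    have "1 + real a \<le> exp (g' i) * 2 powr (real a * real i / real (Suc j))"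
      if i: "i \<in> {1..<Suc j}" for i a
    proof (cases "i = 1")
      case True
      then show ?thesis using first[of "Suc j" a] Suc.hyps by (simp add: g'_def)
    next
      case False
      then have "i - 1 \<in> {1..<j}" using i by auto
      then have "1 + real a \<le> exp (g' i) * 2 powr (real a * real (i - 1) / real j)"
        using g(2)[of "i - 1" a] False by (simp add: g'_def)
      also have "\<dots> \<le> exp (g' i) * 2 powr (real a * real i / real (Suc j))"
      proof (intro mult_left_mono powr_mono)
        have "real (i - 1) / real j \<le> real i / real (Suc j)"
          using i Suc.hyps by (simp add: field_simps of_nat_diff)
        then show "real a * real (i - 1) / real j \<le> real a * real i / real (Suc j)"
          by (metis mult_left_mono of_nat_0_le_iff times_divide_eq_right)
      qed auto
      finally show ?thesis .
    qed
    moreover have "(\<Sum>i=1..<Suc j. real (dyadic_count i) * g' i) \<le> 0.105 * 2 ^ Suc j - 0.3"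
    proof -
      have "(\<Sum>i=1..<Suc j. real (dyadic_count i) * g' i) =
          2 * g' 1 + (\<Sum>i=Suc 1..<Suc j. real (dyadic_count i) * g' i)"
        using Suc.hyps by (subst sum.atLeast_Suc_lessThan) (auto simp: dyadic_count_simps)
      also have "(\<Sum>i=Suc 1..<Suc j. real (dyadic_count i) * g' i) =
          (\<Sum>i=1..<j. real (dyadic_count (Suc i)) * g i)"
        by (subst sum.shift_bounds_Suc_ivl) (auto simp: g'_def intro!: sum.cong)
      \<comment> \<open>Here the count stays at 2 instead of doubling. The saving of
        \<open>2 * g 1\<close> pays for the new term \<open>2 * g' 1\<close> up to their
        difference.\<close>
      also have "\<dots> = 2 * g 1 + (\<Sum>i=Suc 1..<j. real (dyadic_count (Suc i)) * g i)"
        using Suc.hyps by (subst sum.atLeast_Suc_lessThan) (auto simp: dyadic_count_simps)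
      also have "(\<Sum>i=Suc 1..<j. real (dyadic_count (Suc i)) * g i) \<le>
          (\<Sum>i=Suc 1..<j. 2 * (real (dyadic_count i) * g i))"
      proof (rule sum_mono)
        fix i assume i: "i \<in> {Suc 1..<j}"
        have "real (dyadic_count (Suc i)) \<le> 2 * real (dyadic_count i)"
          using of_nat_mono[OF dyadic_count_Suc_le[of i], where ?'a = real] by simp
        from mult_right_mono[OF this, of "g i"] show
          "real (dyadic_count (Suc i)) * g i \<le> 2 * (real (dyadic_count i) * g i)"
          using g0[of i] i by simp
      qed
      also have "\<dots> = 2 * (\<Sum>i=1..<j. real (dyadic_count i) * g i) - 4 * g 1"
        using Suc.hyps
        by (subst (2) sum.atLeast_Suc_lessThan) (auto simp: dyadic_count_simps sum_distrib_left)
      finally have "(\<Sum>i=1..<Suc j. real (dyadic_count i) * g' i) \<le>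
          2 * (\<Sum>i=1..<j. real (dyadic_count i) * g i) + 2 * (g' 1 - g 1)" by simp
      also have "g' 1 - g 1 = ln ((8 * real (Suc j) / 11) / (8 * real j / 11))"
        unfolding g(1) using Suc.hyps by (subst ln_div) (auto simp: g'_def)
      also have "(8 * real (Suc j) / 11) / (8 * real j / 11) = 1 + 1 / real j"
        using Suc.hyps by (simp add: field_simps)
      also have "ln (1 + 1 / real j) \<le> 1 / real j"
        using Suc.hyps by (intro ln_add_one_self_le_self) auto
      \<comment> \<open>This is what the summand \<open>- 0.3\<close> is for: it doubles to
        \<open>- 0.6\<close>, and the increase of at most \<open>2 * 0.15\<close> brings it back to
        \<open>- 0.3\<close>.\<close>
      also have "1 / real j \<le> 0.15" using Suc.hyps by (simp add: field_simps)
      finally show ?thesis using g(3) by simp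
    qed
    ultimately show ?case by (intro exI[of _ g']) (auto simp: g'_def)
  }
qed

text \<open>For 2 and 3 the factor \<open>1 - 1/p\<close> is kept, giving constants with product
  \<open>2/9\<close> times \<open>exp (2 * g 1)\<close>; for larger primes it is bounded by 1 and
  the dyadic weights are used.\<close>

lemma totient_ratio_sum_le_root:
  assumes j: "j \<ge> 7" and m: "m > 0"
  shows "totient_ratio_sum m \<le> 2 / 9 * exp (0.105 * 2 ^ j - 0.3) * real m powr (1 / real j)"
proof -
  obtain g :: "nat \<Rightarrow> real" where g1: "g 1 = ln (8 * real j / 11)"
    and g: "\<And>i a. i \<in> {1..<j} \<Longrightarrow> 1 + real a \<le> exp (g i) * 2 powr (real a * real i / real j)"
    and gsum: "(\<Sum>i=1..<j. real (dyadic_count i) * g i) \<le> 0.105 * 2 ^ j - 0.3"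
    using dyadic_weights[OF j] by blast
  have g0: "g i \<ge> 0" if "i \<in> {1..<j}" for i
    using g[OF that, of 0] by simp
  \<comment> \<open>From \<open>2 ^ j\<close> on, \<open>p powr (a / j) >= 2 ^ a >= 1 + a\<close>,
    so the constant 1 suffices.\<close>
  define C where "C = (\<lambda>p. if p = 2 then 4 * real j / 11 else if p = 3 then 32 * real j / 99
    else if p < 2 ^ j then exp (g (floor_log p)) else 1)"
  define Q where "Q = {p::nat. prime p \<and> 4 \<le> p \<and> p < 2 ^ j}"
  have finQ: "finite Q" by (rule finite_subset[of _ "{..<2 ^ j}"]) (auto simp: Q_def)
  have j4: "(2::nat) ^ 7 \<le> 2 ^ j" using j by (intro power_increasing) auto
  have fl: "floor_log p \<in> {2..<j}" "2 ^ floor_log p \<le> p" "p < 2 ^ Suc (floor_log p)"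
    if "p \<in> Q" for p
  proof -
    have p: "p \<ge> 4" "p < 2 ^ j" using that by (auto simp: Q_def)
    show *: "2 ^ floor_log p \<le> p" "p < 2 ^ Suc (floor_log p)"
      using p floor_log_exp2_le[of p] floor_log_exp2_gt[of p] by auto
    have "floor_log p \<ge> 2" using floor_log_le_iff[OF p(1)] floor_log_power[of 2] by simp
    moreover have "(2::nat) ^ floor_log p < 2 ^ j" using * p by linarith
    then have "floor_log p < j" by simp
    ultimately show "floor_log p \<in> {2..<j}" by simp
  qed
  have "totient_ratio_sum m \<le> (\<Prod>p\<in>{2, 3} \<union> Q. C p) * real m powr (1 / real j)"
  proof (rule totient_ratio_sum_le)
    fix p a :: nat assume p: "prime p"
    have p1: "real p > 1" using prime_gt_1_nat[OF p] by simp
    have le: "1 + real a * (1 - 1 / real p) \<le> 1 + real a"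
      using p1 by (simp add: mult_left_le)
    consider "p = 2" | "p = 3" | "p \<in> Q" | "p \<ge> 2 ^ j"
    proof -
      have "p \<ge> 4" if "p \<noteq> 2" "p \<noteq> 3" using prime_gt_1_nat[OF p] that by linarith
      then show ?thesis using that p by (fastforce simp: Q_def)
    qed
    then show "1 + real a * (1 - 1 / real p) \<le> C p * real p powr (1 / real j * real a)"
    proof cases
      case 1
      have "1 + real a * (1 - 1 / real p) \<le> 4 * real j / 11 * (11 / 8 * (real a / real j) + 3 / 5)"
        using j 1 by (simp add: field_simps)
      also have "\<dots> \<le> 4 * real j / 11 * 2 powr (real a / real j)"
        by (intro mult_left_mono two_powr_ge_affine) auto
      finally show ?thesis using 1 by (simp add: C_def)
    next
      case 2
      have "1 + real a * (1 - 1 / real p) \<le>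
          32 * real j / 99 * (11 / 8 * (3 / 2 * (real a / real j)) + 3 / 5)"
        using j 2 by (simp add: field_simps)
      also have "\<dots> \<le> 32 * real j / 99 * 2 powr (3 / 2 * (real a / real j))"
        by (intro mult_left_mono two_powr_ge_affine) auto
      also have "\<dots> \<le> 32 * real j / 99 * 3 powr (real a / real j)"
      proof (rule mult_left_mono)
        \<comment> \<open>Only \<open>2 ^ 3 <= 3 ^ 2\<close> is behind this.\<close>
        have "2 powr (3 / 2 * (real a / real j)) = (2 powr 3) powr (real a / real j / 2)"
          by (simp only: powr_powr) (simp add: mult.commute)
        also have "\<dots> \<le> (3 powr 2) powr (real a / real j / 2)"
          by (intro powr_mono2) auto
        also have "\<dots> = 3 powr (real a / real j)" by (simp only: powr_powr) simp
        finally show "2 powr (3 / 2 * (real a / real j)) \<le> 3 powr (real a / real j)" .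
      qed auto
      finally show ?thesis using 2 by (simp add: C_def)
    next
      case 3
      define i where "i = floor_log p"
      have "1 + real a \<le> exp (g i) * 2 powr (real a * real i / real j)"
        using fl(1)[OF 3] by (intro g) (auto simp: i_def)
      also have "2 powr (real a * real i / real j) = (2 ^ i) powr (real a / real j)"
        by (simp add: powr_powr mult_ac flip: powr_realpow)
      also have "\<dots> \<le> real p powr (real a / real j)"
        using of_nat_mono[OF fl(2)[OF 3], where ?'a = real] by (intro powr_mono2) (auto simp: i_def)
      finally show ?thesis using 3 le by (auto simp: C_def Q_def i_def)
    next
      case 4
      have "1 + real a \<le> 2 ^ a"
        using Bernoulli_inequality[of 1 a] by simp
      also have "\<dots> = (2 ^ j) powr (real a / real j)"
        using j by (simp add: powr_powr flip: powr_realpow)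
      also have "\<dots> \<le> real p powr (real a / real j)"
        using of_nat_mono[OF 4, where ?'a = real] by (intro powr_mono2) auto
      finally show ?thesis using 4 le j4 by (auto simp: C_def)
    qed
  next
    show "C p = 1" if "prime p" "p \<notin> {2, 3} \<union> Q" for p
    proof -
      have "p \<ge> 4" using prime_gt_1_nat[OF that(1)] that(2) by simp
      then show ?thesis using that by (auto simp: C_def Q_def)
    qed
    show "C p \<ge> 1" if "p \<in> {2, 3} \<union> Q" for p
      using that j fl(1)[of p] g0[of "floor_log p"] by (auto simp: C_def Q_def)
  qed (use finQ m in auto)
  also have "(\<Prod>p\<in>{2, 3} \<union> Q. C p) \<le> 2 / 9 * exp (0.105 * 2 ^ j - 0.3)"
  proof -
    have "(\<Prod>p\<in>{2, 3} \<union> Q. C p) = (4 * real j / 11) * (32 * real j / 99) * (\<Prod>p\<in>Q. C p)"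
      using finQ by (subst prod.union_disjoint) (auto simp: Q_def C_def)
    also have "(\<Prod>p\<in>Q. C p) = exp (\<Sum>p\<in>Q. g (floor_log p))"
      unfolding exp_sum[OF finQ] by (intro prod.cong) (auto simp: C_def Q_def)
    also have "(\<Sum>p\<in>Q. g (floor_log p)) = (\<Sum>i\<in>{2..<j}. \<Sum>p\<in>{p\<in>Q. floor_log p = i}. g (floor_log p))"
      using finQ fl(1) by (intro sum.group[symmetric]) auto
    also have "\<dots> = (\<Sum>i\<in>{2..<j}. real (card {p\<in>Q. floor_log p = i}) * g i)"
    proof (intro sum.cong refl)
      show "(\<Sum>p\<in>{p\<in>Q. floor_log p = i}. g (floor_log p)) = real (card {p\<in>Q. floor_log p = i}) * g i" for i
        using sum.cong[of "{p\<in>Q. floor_log p = i}" _ "\<lambda>p. g (floor_log p)" "\<lambda>_. g i"] by simp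
    qed
    also have "(4 * real j / 11) * (32 * real j / 99) * exp \<dots> \<le>
        (4 * real j / 11) * (32 * real j / 99) * exp (\<Sum>i\<in>{2..<j}. real (dyadic_count i) * g i)"
    proof (rule mult_left_mono, subst exp_le_cancel_iff, rule sum_mono, rule mult_right_mono)
      fix i assume i: "i \<in> {2..<j}"
      have "card {p\<in>Q. floor_log p = i} \<le> card {p::nat. prime p \<and> 2 ^ i \<le> p \<and> p < 2 ^ Suc i}"
      proof (rule card_mono)
        show "finite {p::nat. prime p \<and> 2 ^ i \<le> p \<and> p < 2 ^ Suc i}"
          by (rule finite_subset[of _ "{..<2 ^ Suc i}"]) auto
        show "{p\<in>Q. floor_log p = i} \<subseteq> {p. prime p \<and> 2 ^ i \<le> p \<and> p < 2 ^ Suc i}"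
        proof
          fix p assume "p \<in> {p\<in>Q. floor_log p = i}"
          then show "p \<in> {p. prime p \<and> 2 ^ i \<le> p \<and> p < 2 ^ Suc i}"
            using fl(2,3)[of p] by (simp add: Q_def)
        qed
      qed
      also have "\<dots> \<le> dyadic_count i" using i by (intro card_primes_dyadic_le) auto
      finally show "real (card {p\<in>Q. floor_log p = i}) \<le> real (dyadic_count i)" by simp
      show "g i \<ge> 0" using i by (intro g0) auto
    qed auto
    also have "(4 * real j / 11) * (32 * real j / 99) = 2 / 9 * exp (2 * g 1)"
      unfolding g1 using j by (simp add: exp_double power2_eq_square field_simps)
    also have "2 / 9 * exp (2 * g 1) * exp (\<Sum>i\<in>{2..<j}. real (dyadic_count i) * g i) =
        2 / 9 * exp (\<Sum>i\<in>{1..<j}. real (dyadic_count i) * g i)"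
      using j by (subst (2) sum.atLeast_Suc_lessThan)
        (auto simp: dyadic_count_simps exp_add numeral_2_eq_2)
    also have "\<dots> \<le> 2 / 9 * exp (0.105 * 2 ^ j - 0.3)" using gsum by simp
    finally show ?thesis .
  qed
  finally show ?thesis by (simp add: mult_right_mono)
qed

subsection \<open>The bound \<open>m\<^bsup>1.1 / ln ln m\<^esup>\<close>\<close>

lemma exp_ge_tangent: "exp a * (1 + z - a) \<le> exp (z::real)"
proof -
  have "exp a * (1 + (z - a)) \<le> exp a * exp (z - a)"
    using exp_ge_add_one_self by (intro mult_left_mono) auto
  then show ?thesis by (simp add: exp_diff algebra_simps)
qed

lemma exp_nat_ge: "(2718 / 1000) ^ k \<le> exp (real k)"
proof -
  have "(2718 / 1000 :: real) \<le> exp 1"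
    using abs_le_D2[OF e_approx_32] by simp
  then show ?thesis using power_mono[of "2718 / 1000" "exp (1::real)" k] by (simp flip: exp_of_nat_mult)
qed

text \<open>Replacing \<open>exp z\<close> by its tangent at an integer \<open>k\<close>, with 2.718
  for \<open>exp 1\<close>, turns the estimates below for \<open>c\<close> affine in
  \<open>z\<close> into quadratic inequalities.\<close>

lemma exp_mult_affine_ge:
  fixes z :: real
  assumes "0 \<le> 1 + z - real k" "0 \<le> c"
    "s \<le> (2718 / 1000) ^ k * (1 + z - real k) * c"
  shows "s \<le> exp z * c"
proof -
  have "(2718 / 1000) ^ k * (1 + z - real k) \<le> exp (real k) * (1 + z - real k)"
    using assms by (intro mult_right_mono exp_nat_ge) auto
  also have "\<dots> \<le> exp z" by (rule exp_ge_tangent)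
  finally show ?thesis using assms by (meson mult_right_mono order_trans)
qed

text \<open>By concavity, two evaluations at the ends of an interval suffice; the displayed identity
  makes this explicit.\<close>

lemma concave_quadratic_nonneg:
  fixes a b c l u z :: real
  assumes "l \<le> z" "z \<le> u" "l < u" "a \<ge> 0"
    and "0 \<le> c + b * l - a * l\<^sup>2" "0 \<le> c + b * u - a * u\<^sup>2"
  shows "0 \<le> c + b * z - a * z\<^sup>2"
proof -
  have "(u - l) * (c + b * z - a * z\<^sup>2) = (u - z) * (c + b * l - a * l\<^sup>2)
      + (z - l) * (c + b * u - a * u\<^sup>2) + a * ((u - l) * ((z - l) * (u - z)))"
    by (simp add: algebra_simps power2_eq_square)
  also have "\<dots> \<ge> 0" using assms by (intro add_nonneg_nonneg mult_nonneg_nonneg) auto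
  finally show ?thesis using assms by (simp add: zero_le_mult_iff)
qed

text \<open>In the next three lemmas \<open>z\<close> stands for \<open>ln ln m\<close>.\<close>
lemma mult_le_exp_mult_fifth:
  fixes z :: real
  assumes "0 < z" "z \<le> 5.15"
  shows "2.08 * z \<le> exp z * (1.1 - z / 5)"
proof -
  \<comment> \<open>The tangents at 1, 2, 3 and 5 serve these four intervals in turn. The constant
    2.08 lies just above \<open>ln 8\<close>.\<close>
  consider "z \<le> 1.6" | "1.6 \<le> z" "z \<le> 3" | "3 \<le> z" "z \<le> 4.3" | "4.3 \<le> z" "z \<le> 5.15"
    using assms by linarith
  then show ?thesis
  proof cases
    case 1
    have "0 \<le> 0 + (2.718 * 1.1 - 2.08) * z - 2.718 / 5 * z\<^sup>2"
      by (rule concave_quadratic_nonneg[of "0" z "1.6"]) (use 1 assms in \<open>auto simp: power2_eq_square\<close>)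
    then show ?thesis
      by (intro exp_mult_affine_ge[of z 1]) (use 1 assms in \<open>auto simp: algebra_simps power2_eq_square\<close>)
  next
    case 2
    have "0 \<le> - (2.718\<^sup>2 * 1.1) + (2.718\<^sup>2 * 1.3 - 2.08) * z - 2.718\<^sup>2 / 5 * z\<^sup>2"
      by (rule concave_quadratic_nonneg[of "1.6" z "3"]) (use 2 assms in \<open>auto simp: power2_eq_square\<close>)
    then show ?thesis
      by (intro exp_mult_affine_ge[of z 2]) (use 2 assms in \<open>auto simp: algebra_simps power2_eq_square\<close>)
  next
    case 3
    have "0 \<le> - (2.718 ^ 3 * 2.2) + (2.718 ^ 3 * 1.5 - 2.08) * z - 2.718 ^ 3 / 5 * z\<^sup>2"
      by (rule concave_quadratic_nonneg[of "3" z "4.3"]) (use 3 assms in \<open>auto simp: power2_eq_square eval_nat_numeral\<close>)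
    then show ?thesis
      by (intro exp_mult_affine_ge[of z 3]) (use 3 assms in \<open>auto simp: algebra_simps power2_eq_square eval_nat_numeral\<close>)
  next
    case 4
    have "0 \<le> - (2.718 ^ 5 * 4.4) + (2.718 ^ 5 * 1.9 - 2.08) * z - 2.718 ^ 5 / 5 * z\<^sup>2"
      by (rule concave_quadratic_nonneg[of "4.3" z "5.15"]) (use 4 assms in \<open>auto simp: power2_eq_square eval_nat_numeral\<close>)
    then show ?thesis
      by (intro exp_mult_affine_ge[of z 5]) (use 4 assms in \<open>auto simp: algebra_simps power2_eq_square eval_nat_numeral\<close>)
  qed
qed

lemma mult_le_exp_mult_seventh:
  fixes z :: real
  assumes "5.15 \<le> z" "z \<le> 6.4"
  shows "11.65 * z \<le> exp z * (1.1 - z / 7)"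
proof -
  consider "5.15 \<le> z" "z \<le> 6" | "6 \<le> z" "z \<le> 6.4"
    using assms by linarith
  then show ?thesis
  proof cases
    case 1
    have "0 \<le> - (2.718 ^ 5 * 4.4) + (2.718 ^ 5 * (1.1 + 4 / 7) - 11.65) * z - 2.718 ^ 5 / 7 * z\<^sup>2"
      by (rule concave_quadratic_nonneg[of "5.15" z "6"]) (use 1 assms in \<open>auto simp: power2_eq_square eval_nat_numeral\<close>)
    then show ?thesis
      by (intro exp_mult_affine_ge[of z 5]) (use 1 assms in \<open>auto simp: algebra_simps power2_eq_square eval_nat_numeral\<close>)
  next
    case 2
    have "0 \<le> - (2.718 ^ 6 * 5.5) + (2.718 ^ 6 * (1.1 + 5 / 7) - 11.65) * z - 2.718 ^ 6 / 7 * z\<^sup>2"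
      by (rule concave_quadratic_nonneg[of "6" z "6.4"]) (use 2 assms in \<open>auto simp: power2_eq_square eval_nat_numeral\<close>)
    then show ?thesis
      by (intro exp_mult_affine_ge[of z 6]) (use 2 assms in \<open>auto simp: algebra_simps power2_eq_square eval_nat_numeral\<close>)
  qed
qed

lemma mult_le_exp_mult_jth:
  fixes z :: real and j :: nat
  assumes j: "j \<ge> 8" and z: "0.8 * real j \<le> z" "z \<le> 0.8 * real j + 0.8"
  shows "0.105 * 2 ^ j * z \<le> exp z * (1.1 - z / real j)"
proof -
  define s where "s = z - 0.8 * real j"
  have zs: "z = 0.8 * real j + s" by (simp add: s_def)
  have s: "0 \<le> s" "s \<le> 0.8" using z by (auto simp: s_def)
  have z0: "z > 0" using j z by simp
  have l2: "ln (2::real) \<le> 0.6932"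
    using ln_approx_bounds[of 2 3] by (simp add: eval_nat_numeral)
  \<comment> \<open>The surplus \<open>0.8 - ln 2\<close> is at least 0.1068,
    \<open>exp y >= exp 1 * y\<close>, and \<open>2.718 * 0.1068\<close> exceeds 0.28.\<close>
  have "0.28 * real j * 2 ^ j \<le> exp (0.8 * real j)"
  proof -
    have e: "(2.718 :: real) \<le> exp 1" using exp_nat_ge[of 1] by simp
    define \<kappa> where "\<kappa> = 0.8 - ln (2::real)"
    have \<kappa>: "\<kappa> \<ge> 0.1068" using l2 by (simp add: \<kappa>_def)
    have "0.28 * real j \<le> 2.718 * (0.1068 * real j)" by simp
    also have "\<dots> \<le> exp 1 * (\<kappa> * real j)"
      using e \<kappa> by (intro mult_mono) auto
    also have "\<dots> \<le> exp (\<kappa> * real j)" using exp_ge_tangent[of 1 "\<kappa> * real j"] by simp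
    also have "\<dots> = exp (0.8 * real j) / 2 ^ j"
      by (simp add: \<kappa>_def left_diff_distrib exp_diff powr_def flip: powr_realpow)
    finally show ?thesis by (simp add: field_simps)
  qed
  then have "0.105 * 2 ^ j * z \<le> (exp (0.8 * real j) / (0.28 * real j) * 0.105) * z"
    using j z0 by (intro mult_right_mono) (auto simp: field_simps)
  also have "\<dots> = exp (0.8 * real j) * (0.375 * z / real j)" by simp
  also have "\<dots> \<le> exp (0.8 * real j) * ((1 + s) * (1.1 - z / real j))"
  proof (rule mult_left_mono)
    \<comment> \<open>With \<open>0.375 = 0.105 / 0.28\<close> both sides of the claim agree at
      \<open>s = 0\<close>, so their difference has the factor \<open>s\<close>; the cofactor is
      positive for \<open>j >= 8\<close> and \<open>s <= 0.8\<close>.\<close>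
    have "0 \<le> s * (0.3 * real j - 1.375 - s)" using s j by (intro mult_nonneg_nonneg) auto
    also have "\<dots> = (1 + s) * (1.1 * real j - z) - 0.375 * z"
      unfolding zs by (simp add: field_simps)
    finally have "0.375 * z \<le> (1 + s) * (1.1 * real j - z)" by simp
    then have "0.375 * z / real j \<le> (1 + s) * (1.1 * real j - z) / real j"
      using j by (intro divide_right_mono) auto
    also have "\<dots> = (1 + s) * (1.1 - z / real j)" using j by (simp add: field_simps)
    finally show "0.375 * z / real j \<le> (1 + s) * (1.1 - z / real j)" .
  qed auto
  also have "\<dots> \<le> exp z * (1.1 - z / real j)"
  proof -
    have "z / real j \<le> 1.1" using z j by (simp add: field_simps)
    moreover have "exp (0.8 * real j) * (1 + s) \<le> exp z"
      using exp_ge_tangent[of "0.8 * real j" z] unfolding zs by simp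
    ultimately show ?thesis by (simp only: mult.assoc[symmetric]) (intro mult_right_mono, auto)
  qed
  finally show ?thesis .
qed

text \<open>Taking logarithms, and writing \<open>z = ln x\<close>, leaves
  \<open>C * z <= exp z * (1.1 - \<epsilon> * z)\<close>, the shape of the three preceding
  estimates.\<close>

lemma le_powr_of_ln_le:
  assumes x: "ln x > 0" "x = ln (real m)" "m > 0"
    and F: "F \<le> exp C * real m powr \<epsilon>" and "C * ln x \<le> x * (1.1 - \<epsilon> * ln x)"
  shows "F \<le> real m powr (1.1 / ln x)"
proof -
  have "C \<le> x * (1.1 / ln x - \<epsilon>)" using assms(1,5) by (simp add: field_simps)
  have "F \<le> exp (C + \<epsilon> * x)" using F x by (simp add: powr_def exp_add)
  also have "\<dots> \<le> exp (1.1 / ln x * x)"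
    using \<open>C \<le> _\<close> by (simp add: algebra_simps)
  also have "\<dots> = real m powr (1.1 / ln x)" using x by (simp add: powr_def)
  finally show ?thesis .
qed

text \<open>The root is chosen by the size of \<open>z = ln (ln m)\<close>: fifth up to 5.15,
  seventh up to 6.4, then about the \<open>z / 0.8\<close>-th. As \<open>m >= 3 > exp 1\<close>,
  \<open>z\<close> is positive.\<close>

theorem totient_ratio_sum_le_powr:
  assumes "m \<ge> 3"
  shows "totient_ratio_sum m \<le> real m powr (1.1 / ln (ln (real m)))"
proof -
  define x where "x = ln (real m)"
  define z where "z = ln x"
  have "exp 1 < (3::real)" using e_less_272 by simp
  then have "exp 1 < real m" using assms by linarith
  then have x1: "x > 1" unfolding x_def using assms by (subst ln_less_cancel_iff[of "exp 1", simplified ln_exp]) auto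
  then have z0: "z > 0" by (simp add: z_def)
  have x: "x = exp z" using x1 by (simp add: z_def)
  have m: "m > 0" using assms by simp
  consider "z \<le> 5.15" | "5.15 \<le> z" "z \<le> 6.4" | "6.4 \<le> z" by linarith
  then show ?thesis
  proof cases
    case 1
    have "ln (2::real) \<le> 2.08 / 3"
      using ln_approx_bounds[of 2 3] by (simp add: eval_nat_numeral)
    then have "exp (3 * ln 2) \<le> exp (2.08::real)" by (subst exp_le_cancel_iff) simp
    moreover have "exp (3 * ln 2) = (8::real)" using exp_of_nat_mult[of 3 "ln (2::real)"] by simp
    ultimately have "(8::real) \<le> exp 2.08" by linarith
    then have "totient_ratio_sum m \<le> exp 2.08 * real m powr (1 / 5)"
      using totient_ratio_sum_le_fifth_root[OF m] by (meson mult_right_mono order_trans powr_ge_zero)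
    then show ?thesis unfolding x_def[symmetric]
      by (rule le_powr_of_ln_le[rotated 3])
        (use mult_le_exp_mult_fifth[OF z0 1] x z0 m in \<open>auto simp: z_def[symmetric] x_def[symmetric]\<close>)
  next
    case 2
    have "2 / 9 * exp (0.105 * 2 ^ 7 - 0.3) \<le> exp (11.65::real)"
    proof -
      \<comment> \<open>The factor \<open>2/9\<close> lowers the exponent
        \<open>0.105 * 2^7 - 0.3 = 13.14\<close> to 11.65.\<close>
      have "exp (1.49::real) \<le> 9 / 2"
      proof -
        have "exp (1.5::real) ^ 2 \<le> (9 / 2) ^ 2"
        proof -
          have "exp (1.5::real) ^ 2 = exp 1 ^ 3" by (simp flip: exp_of_nat_mult)
          also have "\<dots> \<le> 2.72 ^ 3" using e_less_272 by (intro power_mono) auto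
          also have "\<dots> \<le> (9 / 2) ^ 2" by (simp add: eval_nat_numeral)
          finally show ?thesis .
        qed
        then have "exp (1.5::real) \<le> 9 / 2" by (rule power2_le_imp_le) auto
        moreover have "exp (1.49::real) \<le> exp 1.5" by simp
        ultimately show ?thesis by linarith
      qed
      then have "2 / 9 * exp (0.105 * 2 ^ 7 - 0.3) \<le> 1 / exp 1.49 * exp (13.14::real)"
        by (intro mult_mono) (auto simp: field_simps)
      also have "\<dots> = exp 11.65" by (simp flip: exp_diff)
      finally show ?thesis .
    qed
    then have "totient_ratio_sum m \<le> exp 11.65 * real m powr (1 / real 7)"
      using totient_ratio_sum_le_root[of 7 m] m
      by (meson mult_right_mono order_trans powr_ge_zero order_refl)
    then show ?thesis unfolding x_def[symmetric]
      by (rule le_powr_of_ln_le[rotated 3])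
        (use mult_le_exp_mult_seventh[OF 2] x z0 m in \<open>auto simp: z_def[symmetric] x_def[symmetric]\<close>)
  next
    case 3
    define j where "j = nat \<lfloor>z / 0.8\<rfloor>"
    have jz: "real j \<le> z / 0.8" "z / 0.8 < real j + 1"
      using z0 unfolding j_def by (auto simp: of_nat_nat) linarith+
    have j8: "j \<ge> 8" using 3 unfolding j_def by (simp add: le_nat_iff le_floor_iff)
    have "2 / 9 * exp (0.105 * 2 ^ j - 0.3) \<le> 1 * exp (0.105 * 2 ^ j :: real)"
      by (intro mult_mono) auto
    then have "2 / 9 * exp (0.105 * 2 ^ j - 0.3) * real m powr (1 / real j) \<le>
        exp (0.105 * 2 ^ j) * real m powr (1 / real j)"
      by (intro mult_right_mono) auto
    then have "totient_ratio_sum m \<le> exp (0.105 * 2 ^ j) * real m powr (1 / real j)"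
      using totient_ratio_sum_le_root[of j m] m j8 by linarith
    then show ?thesis unfolding x_def[symmetric]
      by (rule le_powr_of_ln_le[rotated 3])
        (use mult_le_exp_mult_jth[OF j8, of z] jz x z0 m in \<open>auto simp: z_def[symmetric] x_def[symmetric]\<close>)
  qed
qed

subsection \<open>Finite fields\<close>

text \<open>The distribution proves this only for its class \<open>finite_field\<close>, of which a type variable
  of sort \<open>{field, finite}\<close> is not known to be an instance.\<close>
lemma power_card_UNIV_minus_1:
  fixes x :: "'a::{field,finite}"
  assumes "x \<noteq> 0"
  shows "x ^ (CARD('a) - 1) = 1"
proof -
  have "(\<Prod>y\<in>UNIV-{0}. x * y) = (\<Prod>y\<in>UNIV-{0}. y)"
    by (rule prod.reindex_bij_witness[of _ "\<lambda>y. y / x" "\<lambda>y. x * y"]) (use assms in auto)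
  then have "x ^ (CARD('a) - 1) * \<Prod>(UNIV-{0}) = \<Prod>(UNIV-{0::'a})"
    by (simp add: prod.distrib)
  then show ?thesis by simp
qed

lemma card_power_eq_le:
  fixes y :: "'a::field"
  assumes "d > 0"
  shows "card {x. x ^ d = y} \<le> d"
proof -
  define p where "p = Polynomial.monom 1 d + [:-y:]"
  have deg: "degree p = d"
    unfolding p_def using assms by (subst degree_add_eq_left) (auto simp: degree_monom_eq)
  then have "p \<noteq> 0" using assms by auto
  from card_poly_roots_bound[OF this] deg show ?thesis by (simp add: p_def poly_monom)
qed

lemma add_power_CHAR:
  fixes x y :: "'a::comm_ring_1"
  assumes p: "prime p" and char: "CHAR('a) = p"
  shows "(x + y) ^ p = x ^ p + y ^ p"
proof -
  have "p > 0" using p by (simp add: prime_gt_0_nat)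
  have "(x + y) ^ p = (\<Sum>k\<le>p. of_nat (p choose k) * x ^ k * y ^ (p - k))"
    by (rule binomial_ring)
  also have "\<dots> = (\<Sum>k\<in>{0, p}. of_nat (p choose k) * x ^ k * y ^ (p - k))"
  proof (rule sum.mono_neutral_right)
    show "\<forall>k\<in>{..p} - {0, p}. of_nat (p choose k) * x ^ k * y ^ (p - k) = 0"
    proof
      fix k assume "k \<in> {..p} - {0, p}"
      then have "CHAR('a) dvd (p choose k)" unfolding char using p by (intro dvd_choose_prime) auto
      then have "of_nat (p choose k) = (0::'a)" by (simp add: of_nat_eq_0_iff_char_dvd)
      then show "of_nat (p choose k) * x ^ k * y ^ (p - k) = 0" by simp
    qed
  qed auto
  also have "\<dots> = x ^ p + y ^ p" using \<open>p > 0\<close> by (simp add: add.commute)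
  finally show ?thesis .
qed

lemma add_power_CHAR_power:
  fixes x y :: "'a::comm_ring_1"
  assumes "prime p" "CHAR('a) = p"
  shows "(x + y) ^ (p ^ e) = x ^ (p ^ e) + y ^ (p ^ e)"
proof (induction e)
  case (Suc e)
  have "z ^ (p ^ Suc e) = (z ^ (p ^ e)) ^ p" for z :: 'a
    by (simp add: mult.commute flip: power_mult)
  with Suc show ?case using add_power_CHAR[OF assms] by simp
qed simp

text \<open>The characteristic divides \<open>q ^ n\<close>, so \<open>q\<close> is a power of
  it.\<close>

lemma add_power_primepow:
  fixes x y :: "'a::{field,finite}"
  assumes "primepow q" "CARD('a) = q ^ n"
  shows "(x + y) ^ q = x ^ q + y ^ q"
proof -
  from assms(1) obtain p e where p: "prime p" "q = p ^ e" by (auto simp: primepow_def)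
  have "prime CHAR('a)" by (intro prime_CHAR_semidom finite_imp_CHAR_pos) simp
  moreover have "CHAR('a) dvd p ^ (e * n)"
    using CHAR_dvd_CARD[where ?'a = 'a] assms(2) p by (simp add: power_mult)
  ultimately have "CHAR('a) = p"
    using p by (meson prime_dvd_power primes_dvd_imp_eq)
  then show ?thesis using add_power_CHAR_power[OF p(1)] p(2) by simp
qed

text \<open>At most \<open>q\<close> elements, as roots of a polynomial. At least \<open>q\<close>,
  by the norm map \<open>x ^ M\<close> with \<open>M = (q^n - 1)/(q - 1)\<close>: it sends nonzero
  elements to nonzero roots, with fibres of size at most \<open>M\<close>.\<close>

lemma card_Fq:
  assumes q: "q \<ge> 2" and card: "CARD('a::{field,finite}) = q ^ n"
  shows "card (Fq q :: 'a set) = q"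
proof (rule antisym)
  define p :: "'a poly" where "p = Polynomial.monom 1 q + [:0, -1:]"
  have deg: "degree p = q"
    unfolding p_def using q by (subst degree_add_eq_left) (auto simp: degree_monom_eq)
  then have "p \<noteq> 0" using q by auto
  from card_poly_roots_bound[OF this] deg show "card (Fq q :: 'a set) \<le> q"
    by (simp add: p_def poly_monom Fq_def)
next
  define M where "M = (\<Sum>i<n. q ^ i)"
  have "(q - 1) * (\<Sum>i<n. q ^ i) + 1 = q ^ n"
  proof (induction n)
    case (Suc n)
    then have "(q - 1) * (\<Sum>i<Suc n. q ^ i) + 1 = q ^ n + (q - 1) * q ^ n"
      by (simp add: algebra_simps)
    also have "\<dots> = q ^ Suc n" using q by (cases q) auto
    finally show ?case .
  qed simp
  then have M: "q ^ n - 1 = M * (q - 1)" unfolding M_def by (metis add_diff_cancel_right' mult.commute)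
  have "card {0, 1::'a} \<le> CARD('a)" by (intro card_mono) auto
  then have "q ^ n > 1" using card by simp
  then have "M > 0" using M by (cases "M = 0") auto
  let ?N = "UNIV - {0::'a}" and ?K = "Fq q - {0::'a}"
  have "(\<lambda>x. x ^ M) ` ?N \<subseteq> ?K"
  proof (rule image_subsetI)
    fix x :: 'a assume "x \<in> ?N"
    then have "x \<noteq> 0" by simp
    then have "(x ^ M) ^ (q - 1) = 1"
      using power_card_UNIV_minus_1[of x] unfolding card M by (simp add: power_mult)
    moreover have "(x ^ M) ^ q = (x ^ M) ^ (q - 1) * x ^ M"
      using q by (metis One_nat_def Suc_pred less_le_trans pos2 power_Suc2)
    ultimately show "x ^ M \<in> ?K" using \<open>x \<noteq> 0\<close> by (simp add: Fq_def)
  qed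
  then have "?N = (\<Union>y\<in>?K. {x\<in>?N. x ^ M = y})" by blast
  from arg_cong[OF this, of card] have "card ?N = card (\<Union>y\<in>?K. {x\<in>?N. x ^ M = y})" .
  also have "\<dots> \<le> (\<Sum>y\<in>?K. card {x\<in>?N. x ^ M = y})"
    by (rule card_UN_le) simp
  also have "\<dots> \<le> (\<Sum>y\<in>?K. M)"
  proof (rule sum_mono)
    fix y :: 'a
    have "card {x\<in>?N. x ^ M = y} \<le> card {x. x ^ M = y}" by (intro card_mono) auto
    then show "card {x\<in>?N. x ^ M = y} \<le> M"
      using card_power_eq_le[OF \<open>M > 0\<close>, of y] by linarith
  qed
  also have "\<dots> = card ?K * M" by simp
  finally have "M * (q - 1) \<le> card ?K * M" using card M by (simp add: card_Diff_singleton)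
  then have "q - 1 \<le> card ?K" using \<open>M > 0\<close> by (simp add: mult.commute)
  moreover have "0 \<in> (Fq q :: 'a set)" using q by (simp add: Fq_def)
  then have "card (Fq q :: 'a set) = Suc (card ?K)"
    by (metis card_Suc_Diff1 finite)
  ultimately show "q \<le> card (Fq q :: 'a set)" using q by linarith
qed

section \<open>Multiplicative orders\<close>

lemma mult_ord_props:
  fixes x :: "'a::{field,finite}"
  assumes "x \<noteq> 0"
  shows mult_ord_pos: "mult_ord x > 0" and power_mult_ord: "x ^ mult_ord x = 1"
    and mult_ord_dvd: "x ^ k = 1 \<Longrightarrow> mult_ord x dvd k"
proof -
  have "card {0, 1::'a} \<le> CARD('a)" by (intro card_mono) auto
  then have "CARD('a) - 1 > 0 \<and> x ^ (CARD('a) - 1) = 1"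
    using power_card_UNIV_minus_1[OF assms] by simp
  then have *: "mult_ord x > 0 \<and> x ^ mult_ord x = 1"
    unfolding mult_ord_def by (rule LeastI)
  then show "mult_ord x > 0" "x ^ mult_ord x = 1" by auto
  show "mult_ord x dvd k" if "x ^ k = 1"
  proof (rule ccontr)
    assume "\<not> mult_ord x dvd k"
    then have r: "k mod mult_ord x > 0" by (simp add: mod_greater_zero_iff_not_dvd)
    have "x ^ k = (x ^ mult_ord x) ^ (k div mult_ord x) * x ^ (k mod mult_ord x)"
      by (simp flip: power_mult power_add)
    then have "x ^ (k mod mult_ord x) = 1" using * that by simp
    with r have "mult_ord x \<le> k mod mult_ord x"
      unfolding mult_ord_def[of x] by (intro Least_le) (simp add: mult_ord_def)
    then show False using * by (metis mod_less_divisor not_le)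
  qed
qed

text \<open>If \<open>a\<close> has order \<open>d\<close>, its \<open>d\<close> powers exhaust the
  roots of \<open>x ^ d = 1\<close>, and a power of order \<open>d\<close> has an exponent coprime
  to \<open>d\<close>.\<close>

lemma card_mult_ord_eq_le:
  assumes "d > 0"
  shows "card {x::'a::{field,finite}. x \<noteq> 0 \<and> mult_ord x = d} \<le> totient d"
proof (cases "{x::'a. x \<noteq> 0 \<and> mult_ord x = d} = {}")
  case True
  then show ?thesis by (simp only: card.empty)
next
  case False
  then obtain a :: 'a where a: "a \<noteq> 0" "mult_ord a = d" by blast
  have inj: "inj_on (\<lambda>i. a ^ i) {0<..d}"
  proof (rule linorder_inj_onI)
    fix i k assume ik: "i < k" "i \<in> {0<..d}" "k \<in> {0<..d}"
    show "a ^ i \<noteq> a ^ k"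
    proof
      assume "a ^ i = a ^ k"
      also have "a ^ k = a ^ i * a ^ (k - i)" using ik by (simp flip: power_add)
      finally have "a ^ (k - i) = 1" using a by simp
      then have "d dvd k - i" using mult_ord_dvd[OF a(1)] a(2) by simp
      then show False using ik by (auto dest: dvd_imp_le)
    qed
  qed auto
  have "(\<lambda>i. a ^ i) ` {0<..d} = {x. x ^ d = 1}"
  proof (rule card_seteq)
    show "(\<lambda>i. a ^ i) ` {0<..d} \<subseteq> {x. x ^ d = 1}"
    proof clarify
      fix i
      have "(a ^ i) ^ d = (a ^ d) ^ i" by (simp add: mult.commute flip: power_mult)
      then show "(a ^ i) ^ d = 1" using power_mult_ord[OF a(1)] a(2) by simp
    qed
    show "card {x::'a. x ^ d = 1} \<le> card ((\<lambda>i. a ^ i) ` {0<..d})"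
      using card_power_eq_le[OF assms, of "1::'a"] by (simp add: card_image[OF inj])
  qed simp
  note roots = this
  have "{x::'a. x \<noteq> 0 \<and> mult_ord x = d} \<subseteq> (\<lambda>i. a ^ i) ` totatives d"
  proof clarify
    fix x :: 'a assume x: "x \<noteq> 0" "d = mult_ord x"
    then have "x ^ d = 1" using power_mult_ord by blast
    then obtain i where i: "i \<in> {0<..d}" "x = a ^ i" using roots by blast
    \<comment> \<open>Then \<open>x ^ (d / g) = 1\<close>, which forces \<open>g = 1\<close> because
      \<open>x\<close> has order \<open>d\<close>.\<close>
    define g where "g = gcd i d"
    have "g > 0" using assms by (simp add: g_def)
    obtain i' d' where id: "i = g * i'" "d = g * d'" unfolding g_def by (meson dvdE gcd_dvd1 gcd_dvd2)
    have "x ^ d' = (a ^ d) ^ i'" by (simp add: i id mult_ac flip: power_mult)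
    then have "x ^ d' = 1" using power_mult_ord[OF a(1)] a(2) by simp
    then have "d dvd d'" using mult_ord_dvd[OF x(1)] x(2) by simp
    then have "g = 1" using id assms by (auto dest!: dvd_imp_le)
    then have "coprime i d" by (simp only: g_def coprime_iff_gcd_eq_1)
    then have "i \<in> totatives d" using i by (simp add: totatives_def)
    then show "x \<in> (\<lambda>i. a ^ i) ` totatives (mult_ord x)" using i x by blast
  qed
  then have "card {x::'a. x \<noteq> 0 \<and> mult_ord x = d} \<le> card ((\<lambda>i. a ^ i) ` totatives d)"
    by (intro card_mono) auto
  also have "\<dots> \<le> totient d" unfolding totient_def by (intro card_image_le) auto
  finally show ?thesis .
qed

subsection \<open>Generators of cyclic modules\<close>

text \<open>Modelled on \<open>K = Fq q\<close> and the Frobenius map \<open>x ^ q\<close>, which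
  fixes \<open>K\<close> pointwise and is therefore \<open>K\<close>-linear.\<close>

locale semilinear_module =
  fixes K :: "'a::{field,finite} set" and \<phi> :: "'a \<Rightarrow> 'a"
  assumes K_1: "1 \<in> K"
    and K_add: "\<And>c d. c \<in> K \<Longrightarrow> d \<in> K \<Longrightarrow> c + d \<in> K"
    and K_mult: "\<And>c d. c \<in> K \<Longrightarrow> d \<in> K \<Longrightarrow> c * d \<in> K"
    and K_minus: "\<And>c. c \<in> K \<Longrightarrow> - c \<in> K"
    and K_inverse: "\<And>c. c \<in> K \<Longrightarrow> inverse c \<in> K"
    and \<phi>_add: "\<And>x y. \<phi> (x + y) = \<phi> x + \<phi> y"
    and \<phi>_scale: "\<And>c x. c \<in> K \<Longrightarrow> \<phi> (c * x) = c * \<phi> x"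
begin

text \<open>The commutative ring \<open>K[\<phi>]\<close> of operators.\<close>
inductive_set ops :: "('a \<Rightarrow> 'a) set" where
  scale: "c \<in> K \<Longrightarrow> (\<lambda>x. c * x) \<in> ops"
| shift: "f \<in> ops \<Longrightarrow> (\<lambda>x. \<phi> (f x)) \<in> ops"
| plus: "f \<in> ops \<Longrightarrow> g \<in> ops \<Longrightarrow> (\<lambda>x. f x + g x) \<in> ops"

lemma ops_add: "f \<in> ops \<Longrightarrow> f (x + y) = f x + f y"
  by (induction rule: ops.induct) (auto simp: algebra_simps \<phi>_add)

lemma ops_scale: "f \<in> ops \<Longrightarrow> c \<in> K \<Longrightarrow> f (c * x) = c * f x"
  by (induction rule: ops.induct) (auto simp: algebra_simps \<phi>_scale)

lemma ops_shift: "f \<in> ops \<Longrightarrow> f (\<phi> x) = \<phi> (f x)"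
  by (induction rule: ops.induct) (auto simp: \<phi>_add \<phi>_scale)

lemma ops_commute: "f \<in> ops \<Longrightarrow> g \<in> ops \<Longrightarrow> f (g x) = g (f x)"
  by (induction arbitrary: x rule: ops.induct) (auto simp: ops_add ops_scale ops_shift)

lemma ops_scale_left: "g \<in> ops \<Longrightarrow> c \<in> K \<Longrightarrow> (\<lambda>x. c * g x) \<in> ops"
proof (induction rule: ops.induct)
  case (scale d)
  have "(\<lambda>x. c * (d * x)) = (\<lambda>x. (c * d) * x)" by (simp add: mult.assoc)
  with scale show ?case using ops.scale[OF K_mult[of c d]] by simp
next
  case (shift f)
  then show ?case using ops.shift[of "\<lambda>x. c * f x"] by (simp add: \<phi>_scale)
next
  case (plus f g)
  then show ?case using ops.plus[of "\<lambda>x. c * f x" "\<lambda>x. c * g x"] by (simp add: distrib_left)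
qed

lemma ops_comp: "f \<in> ops \<Longrightarrow> g \<in> ops \<Longrightarrow> (\<lambda>x. f (g x)) \<in> ops"
  by (induction rule: ops.induct) (auto intro: ops_scale_left ops.shift ops.plus)

lemma ops_id: "(\<lambda>x. x) \<in> ops"
proof -
  have "(\<lambda>x. x) = (\<lambda>x::'a. 1 * x)" by simp
  then show ?thesis by (metis ops.scale[OF K_1])
qed

lemma K_0: "0 \<in> K"
  using K_add[OF K_1 K_minus[OF K_1]] by simp

lemma ops_zero: "(\<lambda>x. 0) \<in> ops"
proof -
  have "(\<lambda>x. 0) = (\<lambda>x::'a. 0 * x)" by simp
  then show ?thesis by (metis ops.scale[OF K_0])
qed

lemma ops_minus: "f \<in> ops \<Longrightarrow> g \<in> ops \<Longrightarrow> (\<lambda>x. f x - g x) \<in> ops"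
  using ops.plus[of f "\<lambda>x. - 1 * g x"] ops_scale_left[of g "- 1"] K_minus[OF K_1] by simp

section \<open>Submodules and cyclic submodules\<close>

definition submod :: "'a set \<Rightarrow> bool" where
  "submod W \<longleftrightarrow> 0 \<in> W \<and> (\<forall>x\<in>W. \<forall>y\<in>W. x + y \<in> W) \<and> (\<forall>f\<in>ops. \<forall>x\<in>W. f x \<in> W)"

text \<open>The cyclic \<open>K[\<phi>]\<close>-submodule generated by \<open>v\<close>, not merely
  its iterates under \<open>\<phi>\<close>.\<close>

definition orbit :: "'a \<Rightarrow> 'a set" where
  "orbit v = (\<lambda>f. f v) ` ops"

lemma submod_diff: "submod W \<Longrightarrow> x \<in> W \<Longrightarrow> y \<in> W \<Longrightarrow> x - y \<in> W"
  using ops.scale[OF K_minus[OF K_1]] unfolding submod_def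
  by (metis ab_group_add_class.ab_diff_conv_add_uminus mult_minus1)

lemma submod_scale: "submod W \<Longrightarrow> c \<in> K \<Longrightarrow> x \<in> W \<Longrightarrow> c * x \<in> W"
  using ops.scale unfolding submod_def by blast

lemma submod_orbit: "submod (orbit v)"
  unfolding submod_def orbit_def
proof (intro conjI ballI)
  show "0 \<in> (\<lambda>f. f v) ` ops" using ops_zero by force
  show "x + y \<in> (\<lambda>f. f v) ` ops" if "x \<in> (\<lambda>f. f v) ` ops" "y \<in> (\<lambda>f. f v) ` ops" for x y
    using that ops.plus by force
  show "f x \<in> (\<lambda>f. f v) ` ops" if "f \<in> ops" "x \<in> (\<lambda>f. f v) ` ops" for f x
    using that ops_comp by force
qed

lemma orbit_self: "v \<in> orbit v"
  using ops_id unfolding orbit_def by force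

lemma orbit_subset: "v \<in> orbit u \<Longrightarrow> orbit v \<subseteq> orbit u"
  unfolding orbit_def using ops_comp by force

text \<open>The elements that generate \<open>orbit \<alpha>\<close> modulo \<open>W\<close>: true
  generators for \<open>W = {0}\<close>, all of \<open>orbit \<alpha>\<close> for
  \<open>W = orbit \<alpha>\<close>.\<close>

definition gens :: "'a \<Rightarrow> 'a set \<Rightarrow> 'a set" where
  "gens \<alpha> W = {v \<in> orbit \<alpha>. \<exists>f\<in>ops. \<exists>w\<in>W. \<alpha> = f v + w}"

lemma gensI: "v \<in> orbit \<alpha> \<Longrightarrow> f \<in> ops \<Longrightarrow> w \<in> W \<Longrightarrow> \<alpha> = f v + w \<Longrightarrow> v \<in> gens \<alpha> W"
  unfolding gens_def by blast

text \<open>Modulo \<open>W'\<close>, the minimal submodule \<open>W\<close> is annihilated by every \<open>v\<close> that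
  generates modulo \<open>W\<close> but not modulo \<open>W'\<close>; two such elements that agree modulo \<open>W\<close>
  therefore agree modulo \<open>W'\<close>.\<close>
lemma nongens_cong:
  assumes W: "submod W" "W \<subseteq> orbit \<alpha>" and W': "submod W'" "W' \<subseteq> W"
    and max: "\<And>S. submod S \<Longrightarrow> W' \<subseteq> S \<Longrightarrow> S \<subseteq> W \<Longrightarrow> S = W' \<or> S = W"
    and v: "v \<in> gens \<alpha> W" "v \<notin> gens \<alpha> W'" and w: "w \<in> gens \<alpha> W" "w \<notin> gens \<alpha> W'"
    and vw: "w - v \<in> W"
  shows "w - v \<in> W'"
proof -
  \<comment> \<open>The intersection \<open>S\<close> of \<open>W\<close> with
    \<open>orbit u + W'\<close> lies between \<open>W'\<close> and \<open>W\<close>. It is not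
    \<open>W\<close>, since then \<open>u\<close> would generate modulo \<open>W'\<close>; so it is
    \<open>W'\<close>.\<close>
  have key: "x \<in> W'" if u: "u \<in> gens \<alpha> W" "u \<notin> gens \<alpha> W'" and x: "x \<in> orbit u" "x \<in> W" for u x
  proof -
    define S where "S = {y \<in> W. \<exists>h\<in>ops. \<exists>z\<in>W'. y = h u + z}"
    have SI: "y \<in> S" if "y \<in> W" "h \<in> ops" "z \<in> W'" "y = h u + z" for y h z
      using that unfolding S_def by blast
    have "submod S"
      unfolding submod_def
    proof (intro conjI ballI)
      show "0 \<in> S" by (rule SI[OF _ ops_zero, of _ 0]) (use W(1) W'(1) in \<open>auto simp: submod_def\<close>)
    next
      fix x y assume "x \<in> S" "y \<in> S"
      then obtain h1 z1 h2 z2 where "x \<in> W" "y \<in> W" "h1 \<in> ops" "z1 \<in> W'" "x = h1 u + z1"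
        "h2 \<in> ops" "z2 \<in> W'" "y = h2 u + z2" unfolding S_def by blast
      then show "x + y \<in> S" using W(1) W'(1)
        by (intro SI[OF _ ops.plus[of h1 h2], of _ "z1 + z2"]) (auto simp: submod_def)
    next
      fix f y assume f: "f \<in> ops" and "y \<in> S"
      then obtain h z where "y \<in> W" "h \<in> ops" "z \<in> W'" "y = h u + z" unfolding S_def by blast
      moreover from \<open>y \<in> W\<close> have "f y \<in> W" using W(1) f unfolding submod_def by blast
      ultimately show "f y \<in> S" using W'(1) f ops_add[OF f, of "h u" z]
        by (intro SI[OF _ ops_comp[OF f, of h], of _ "f z"]) (simp_all add: submod_def)
    qed
    moreover have "W' \<subseteq> S"
    proof
      fix z assume "z \<in> W'"
      then show "z \<in> S" using W' by (intro SI[OF _ ops_zero, of _ z]) auto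
    qed
    moreover have "S \<subseteq> W" by (auto simp: S_def)
    moreover have "S \<noteq> W"
    proof
      assume "S = W"
      from u(1) obtain f y where f: "f \<in> ops" "y \<in> W" "\<alpha> = f u + y" and uo: "u \<in> orbit \<alpha>"
        unfolding gens_def by blast
      from \<open>y \<in> W\<close> \<open>S = W\<close> obtain h z where h: "h \<in> ops" "z \<in> W'" "y = h u + z"
        unfolding S_def by blast
      have "u \<in> gens \<alpha> W'"
        using f h by (intro gensI[OF uo ops.plus[OF f(1) h(1)] h(2)]) simp
      with u(2) show False ..
    qed
    ultimately have "S = W'" using max by blast
    moreover have "x \<in> S"
      using x W'(1) unfolding S_def orbit_def submod_def by force
    ultimately show ?thesis by blast
  qed
  obtain f g where f: "f \<in> ops" "v = f \<alpha>" and g: "g \<in> ops" "w = g \<alpha>"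
    using v(1) w(1) unfolding gens_def orbit_def by blast
  define e where "e = (\<lambda>x. g x - f x)"
  have e: "e \<in> ops" "w - v = e \<alpha>" using ops_minus f g by (auto simp: e_def)
  obtain s y where s: "s \<in> ops" "y \<in> W" "\<alpha> = s v + y"
    using v(1) unfolding gens_def by blast
  obtain h where h: "h \<in> ops" "y = h \<alpha>" using s(2) W(2) unfolding orbit_def by blast
  have "e v = f (w - v)" using e f ops_commute by simp
  then have "e v \<in> W" using vw f W(1) unfolding submod_def by simp
  then have "e v \<in> W'" using v e(1) by (intro key[of v]) (auto simp: orbit_def)
  then have "s (e v) \<in> W'" using s(1) W'(1) unfolding submod_def by blast
  moreover have "h v = f y" "h w = g y" using f g h ops_commute by auto
  then have "h v \<in> W" "h w \<in> W" using f g s(2) W(1) unfolding submod_def by auto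
  then have "h v \<in> W'" "h w \<in> W'"
    using key[of v "h v"] key[of w "h w"] v w h(1) by (auto simp: orbit_def)
  then have "h w - h v \<in> W'" using submod_diff[OF W'(1)] by blast
  \<comment> \<open>Apply \<open>e\<close> to \<open>\<alpha> = s v + y\<close> with
    \<open>y = h \<alpha>\<close> and commute: \<open>e (s v) = s (e v)\<close> and
    \<open>e y = h (e \<alpha>) = h w - h v\<close>.\<close>
  moreover have "w - v = s (e v) + (h w - h v)"
  proof -
    have hwv: "h w - h v = h (w - v)" using ops_add[OF h(1), of v "w - v"] by simp
    have "w - v = e (s v) + e y" using e(2) s(3) ops_add[OF e(1)] by metis
    also have "e (s v) = s (e v)" by (rule ops_commute[OF e(1) s(1)])
    also have "e y = h (w - v)" unfolding e(2) h(2) by (rule ops_commute[OF e(1) h(1)])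
    finally show ?thesis unfolding hwv .
  qed
  ultimately show ?thesis using W'(1) unfolding submod_def by simp
qed

lemma gens_mono: "W' \<subseteq> W \<Longrightarrow> gens \<alpha> W' \<subseteq> gens \<alpha> W"
  unfolding gens_def by blast

lemma gens_add:
  assumes W: "submod W" "W \<subseteq> orbit \<alpha>" and v: "v \<in> gens \<alpha> W" and w: "w \<in> W"
  shows "v + w \<in> gens \<alpha> W"
proof -
  from v obtain f y where f: "f \<in> ops" "y \<in> W" "\<alpha> = f v + y" and vo: "v \<in> orbit \<alpha>"
    unfolding gens_def by blast
  have "v + w \<in> orbit \<alpha>" using vo w W(2) submod_orbit unfolding submod_def by blast
  moreover have "\<alpha> = f (v + w) + (y - f w)" using f ops_add[OF f(1)] by simp
  moreover have "y - f w \<in> W" using submod_diff[OF W(1)] f w W(1) unfolding submod_def by blast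
  ultimately show ?thesis using f(1) unfolding gens_def by blast
qed

lemma scale_notin_submod:
  assumes "submod W'" "\<kappa> \<notin> W'" "c \<in> K" "d \<in> K" "c * \<kappa> - d * \<kappa> \<in> W'"
  shows "c = d"
proof (rule ccontr)
  assume "c \<noteq> d"
  have "c - d \<in> K" using K_add[OF assms(3) K_minus[OF assms(4)]] by simp
  then have "inverse (c - d) * (c * \<kappa> - d * \<kappa>) \<in> W'"
    using submod_scale[OF assms(1) K_inverse] assms(5) by blast
  moreover have "inverse (c - d) * (c * \<kappa> - d * \<kappa>) = \<kappa>"
    using \<open>c \<noteq> d\<close> by (simp add: left_diff_distrib[symmetric] mult.assoc[symmetric])
  ultimately show False using assms(2) by simp
qed

text \<open>For \<open>\<kappa>\<close> in \<open>W\<close> outside \<open>W'\<close>, translation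
  by the multiples \<open>c * \<kappa>\<close> gives \<open>card K\<close> disjoint copies of
  \<open>W'\<close> inside \<open>W\<close>, and likewise of the elements lost from \<open>W\<close>
  to \<open>W'\<close> inside \<open>gens \<alpha> W\<close>.\<close>

lemma card_gens_step:
  assumes W: "submod W" "W \<subseteq> orbit \<alpha>" and W': "submod W'" "W' \<subset> W"
    and max: "\<And>S. submod S \<Longrightarrow> W' \<subseteq> S \<Longrightarrow> S \<subseteq> W \<Longrightarrow> S = W' \<or> S = W"
  shows "card K * card W' \<le> card W"
    and "card K * card (gens \<alpha> W - gens \<alpha> W') \<le> card (gens \<alpha> W)"
proof -
  obtain \<kappa> where \<kappa>: "\<kappa> \<in> W" "\<kappa> \<notin> W'" using W'(2) by blast
  have "inj_on (\<lambda>(c, u). c * \<kappa> + u) (K \<times> W')"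
  proof (rule inj_onI, clarify)
    fix c u d t assume *: "c \<in> K" "u \<in> W'" "d \<in> K" "t \<in> W'" "c * \<kappa> + u = d * \<kappa> + t"
    have "c * \<kappa> - d * \<kappa> = t - u" using *(5) by (simp add: algebra_simps)
    then have "c = d" using scale_notin_submod[OF W'(1) \<kappa>(2)] submod_diff[OF W'(1)] * by metis
    with *(5) show "c = d \<and> u = t" by simp
  qed
  moreover have "(\<lambda>(c, u). c * \<kappa> + u) ` (K \<times> W') \<subseteq> W"
    using submod_scale[OF W(1) _ \<kappa>(1)] W W' unfolding submod_def by auto
  ultimately show "card K * card W' \<le> card W"
    by (metis card_cartesian_product card_inj_on_le finite)
  define N where "N = gens \<alpha> W - gens \<alpha> W'"
  have "inj_on (\<lambda>(c, v). v + c * \<kappa>) (K \<times> N)"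
  proof (rule inj_onI, clarify)
    fix c v d w assume *: "c \<in> K" "v \<in> N" "d \<in> K" "w \<in> N" "v + c * \<kappa> = w + d * \<kappa>"
    have wv: "w - v = c * \<kappa> - d * \<kappa>" using *(5) by (simp add: algebra_simps)
    have "w - v \<in> W" unfolding wv
      using submod_diff[OF W(1)] submod_scale[OF W(1) _ \<kappa>(1)] * by blast
    then have "w - v \<in> W'"
      using nongens_cong[OF W W'(1) _ max, of v w] *(2,4) W'(2) unfolding N_def by blast
    then have "c = d" using scale_notin_submod[OF W'(1) \<kappa>(2)] *(1,3) wv by metis
    with *(5) show "c = d \<and> v = w" by simp
  qed
  moreover have "(\<lambda>(c, v). v + c * \<kappa>) ` (K \<times> N) \<subseteq> gens \<alpha> W"
    using gens_add[OF W] submod_scale[OF W(1) _ \<kappa>(1)] unfolding N_def by auto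
  ultimately show "card K * card (gens \<alpha> W - gens \<alpha> W') \<le> card (gens \<alpha> W)"
    unfolding N_def by (metis card_cartesian_product card_inj_on_le finite)
qed

text \<open>Here \<open>e\<close> is the length of a chain from \<open>orbit \<alpha>\<close> down
  to \<open>W\<close>. Each step divides the size by at least \<open>card K\<close> and keeps at
  least the fraction \<open>1 - 1 / card K\<close> of the generators.\<close>

lemma card_gens_ge:
  assumes "submod W" "W \<subseteq> orbit \<alpha>"
  shows "\<exists>e. card W * card K ^ e \<le> card (orbit \<alpha>) \<and>
    card (orbit \<alpha>) * (card K - 1) ^ e \<le> card (gens \<alpha> W) * card K ^ e"
  using assms
proof (induction "card (orbit \<alpha>) - card W" arbitrary: W rule: less_induct)
  case less
  show ?case
  proof (cases "W = orbit \<alpha>")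
    case True
    have "orbit \<alpha> \<subseteq> gens \<alpha> W"
    proof
      fix v assume v: "v \<in> orbit \<alpha>"
      show "v \<in> gens \<alpha> W" by (rule gensI[OF v ops_zero, of \<alpha>]) (use True orbit_self in auto)
    qed
    then have "card (orbit \<alpha>) \<le> card (gens \<alpha> W)" by (intro card_mono) auto
    then show ?thesis using True by (intro exI[of _ 0]) auto
  next
    case False
    define P where "P = (\<lambda>S. submod S \<and> W \<subset> S \<and> S \<subseteq> orbit \<alpha>)"
    have "P (orbit \<alpha>)" using False less.prems submod_orbit by (auto simp: P_def)
    \<comment> \<open>A submodule of least size strictly above \<open>W\<close>, so that none lies
      in between.\<close>
    then obtain S where S: "P S" and min: "\<And>T. P T \<Longrightarrow> card S \<le> card T"
      using ex_has_least_nat[of P "orbit \<alpha>" card] by blast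
    have max: "T = W \<or> T = S" if "submod T" "W \<subseteq> T" "T \<subseteq> S" for T
    proof (rule ccontr)
      assume *: "\<not> (T = W \<or> T = S)"
      then have "P T" using that S by (auto simp: P_def)
      moreover have "card T < card S" using * that by (intro psubset_card_mono) auto
      ultimately show False using min[of T] by simp
    qed
    have S': "submod S" "W \<subset> S" "S \<subseteq> orbit \<alpha>" using S by (auto simp: P_def)
    have "card W < card S" using S' by (intro psubset_card_mono) auto
    moreover have "card S \<le> card (orbit \<alpha>)" using S' by (intro card_mono) auto
    ultimately have "card (orbit \<alpha>) - card S < card (orbit \<alpha>) - card W" by simp
    from less.hyps[OF this S'(1,3)] obtain e where e: "card S * card K ^ e \<le> card (orbit \<alpha>)"
      "card (orbit \<alpha>) * (card K - 1) ^ e \<le> card (gens \<alpha> S) * card K ^ e" by blast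
    note step = card_gens_step[OF S'(1,3) less.prems(1) S'(2) max]
    have "card W * card K ^ Suc e = card K * card W * card K ^ e" by simp
    also have "\<dots> \<le> card S * card K ^ e" using step(1) by (intro mult_right_mono) auto
    also have "\<dots> \<le> card (orbit \<alpha>)" by (rule e(1))
    finally have 1: "card W * card K ^ Suc e \<le> card (orbit \<alpha>)" .
    have sub: "gens \<alpha> W \<subseteq> gens \<alpha> S" using S' by (intro gens_mono) auto
    have "card (gens \<alpha> S) = card (gens \<alpha> S - gens \<alpha> W) + card (gens \<alpha> W)"
      using card_Diff_subset[OF _ sub] card_mono[OF _ sub] by simp
    then have "card K * card (gens \<alpha> S) \<le> card (gens \<alpha> S) + card K * card (gens \<alpha> W)"
      using step(2) by (simp add: distrib_left)
    then have "(card K - 1) * card (gens \<alpha> S) \<le> card K * card (gens \<alpha> W)"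
      by (simp add: diff_mult_distrib)
    then have *: "(card K - 1) * card (gens \<alpha> S) * card K ^ e \<le> card K * card (gens \<alpha> W) * card K ^ e"
      by (intro mult_right_mono) auto
    have "card (orbit \<alpha>) * (card K - 1) ^ Suc e = (card K - 1) * (card (orbit \<alpha>) * (card K - 1) ^ e)"
      by (simp only: power_Suc mult_ac)
    also have "\<dots> \<le> (card K - 1) * (card (gens \<alpha> S) * card K ^ e)"
      by (intro mult_left_mono e(2)) auto
    also have "\<dots> \<le> card K * card (gens \<alpha> W) * card K ^ e"
      using * by (simp only: mult.assoc)
    also have "\<dots> = card (gens \<alpha> W) * card K ^ Suc e" by (simp only: power_Suc mult_ac)
    finally have "card (orbit \<alpha>) * (card K - 1) ^ Suc e \<le> card (gens \<alpha> W) * card K ^ Suc e" .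
    with 1 show ?thesis by blast
  qed
qed

lemma card_orbit_generators_ge:
  assumes card: "card (orbit \<alpha>) = card K ^ r" and K: "card K \<ge> 2"
  shows "(card K - 1) ^ r \<le> card {v. orbit v = orbit \<alpha>}"
proof -
  have "f 0 = 0" if "f \<in> ops" for f using ops_scale[OF that K_0, of 0] by simp
  then have "submod {0}" unfolding submod_def by auto
  moreover have "{0} \<subseteq> orbit \<alpha>" using submod_orbit unfolding submod_def by auto
  ultimately obtain e where e: "card {0::'a} * card K ^ e \<le> card (orbit \<alpha>)"
      "card (orbit \<alpha>) * (card K - 1) ^ e \<le> card (gens \<alpha> {0}) * card K ^ e"
    using card_gens_ge by blast
  \<comment> \<open>So the loss \<open>(1 - 1 / card K) ^ e\<close> is at worst the same power with
    exponent \<open>r\<close>.\<close>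
  have "e \<le> r" using e(1) card K by simp
  have "gens \<alpha> {0} \<subseteq> {v. orbit v = orbit \<alpha>}"
  proof clarify
    fix v assume "v \<in> gens \<alpha> {0}"
    then have "v \<in> orbit \<alpha>" "\<alpha> \<in> orbit v" by (auto simp: gens_def orbit_def)
    then show "orbit v = orbit \<alpha>" using orbit_subset by blast
  qed
  then have le: "card (gens \<alpha> {0}) \<le> card {v. orbit v = orbit \<alpha>}" by (intro card_mono) auto
  have "(card K - 1) ^ r * card K ^ e = (card K - 1) ^ (r - e) * ((card K - 1) ^ e * card K ^ e)"
    using \<open>e \<le> r\<close> by (simp flip: power_add mult.assoc)
  also have "\<dots> \<le> card K ^ (r - e) * ((card K - 1) ^ e * card K ^ e)"
    by (intro mult_right_mono power_mono) auto
  also have "\<dots> = card (orbit \<alpha>) * (card K - 1) ^ e"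
    using \<open>e \<le> r\<close> by (simp add: card mult_ac flip: power_add)
  also have "\<dots> \<le> card (gens \<alpha> {0}) * card K ^ e" by (rule e(2))
  finally show ?thesis using K le by simp
qed

end

subsection \<open>Counting \<open>k\<close>-normal elements\<close>

text \<open>Coefficients are padded with zeros to all of \<open>S\<close>, so that the span becomes
  the image of one finite function space.\<close>

lemma lin_span_eq_image:
  assumes "finite S" "0 \<in> K"
  shows "lin_span K S = (\<lambda>c. \<Sum>b\<in>S. c b * b) ` (S \<rightarrow>\<^sub>E K)"
proof (intro equalityI subsetI)
  fix x assume "x \<in> lin_span K S"
  then obtain B c where B: "finite B" "B \<subseteq> S" "\<forall>b\<in>B. c b \<in> K" "x = (\<Sum>b\<in>B. c b * b)"
    unfolding lin_span_def by blast
  define d where "d = (\<lambda>b\<in>S. if b \<in> B then c b else 0)"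
  have "x = (\<Sum>b\<in>S. d b * b)"
    unfolding B(4) using assms B(2) by (intro sum.mono_neutral_cong_left) (auto simp: d_def)
  moreover have "d \<in> S \<rightarrow>\<^sub>E K" using B assms by (auto simp: d_def)
  ultimately show "x \<in> (\<lambda>c. \<Sum>b\<in>S. c b * b) ` (S \<rightarrow>\<^sub>E K)" by blast
next
  fix x assume "x \<in> (\<lambda>c. \<Sum>b\<in>S. c b * b) ` (S \<rightarrow>\<^sub>E K)"
  then show "x \<in> lin_span K S" unfolding lin_span_def using assms by blast
qed

lemma lin_span_add:
  assumes "finite S" "0 \<in> K" "\<And>c d. c \<in> K \<Longrightarrow> d \<in> K \<Longrightarrow> c + d \<in> K"
    and "x \<in> lin_span K S" "y \<in> lin_span K S"
  shows "x + y \<in> lin_span K S"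
proof -
  from assms(4,5) obtain c d where cd: "c \<in> S \<rightarrow>\<^sub>E K" "d \<in> S \<rightarrow>\<^sub>E K"
      "x = (\<Sum>b\<in>S. c b * b)" "y = (\<Sum>b\<in>S. d b * b)"
    unfolding lin_span_eq_image[OF assms(1,2)] by blast
  have "x + y = (\<Sum>b\<in>S. (\<lambda>b\<in>S. c b + d b) b * b)"
    by (simp add: cd distrib_right sum.distrib)
  moreover have "(\<lambda>b\<in>S. c b + d b) \<in> S \<rightarrow>\<^sub>E K" using cd assms(3) by auto
  ultimately show ?thesis unfolding lin_span_eq_image[OF assms(1,2)] by blast
qed

lemma lin_span_scale_mem: "c \<in> K \<Longrightarrow> b \<in> S \<Longrightarrow> c * b \<in> lin_span K S"
  unfolding lin_span_def by (intro CollectI exI[of _ "{b}"] exI[of _ "\<lambda>_. c"]) auto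

lemma card_has_dim:
  assumes dim: "has_dim K V d" and K: "finite K" "0 \<in> K" "\<And>c d. c \<in> K \<Longrightarrow> d \<in> K \<Longrightarrow> c - d \<in> K"
  shows "card V = card K ^ d"
proof -
  obtain B where B: "lin_indep K B" "lin_span K B = V" "card B = d"
    using dim unfolding has_dim_def by blast
  have fin: "finite B" using B(1) by (simp add: lin_indep_def)
  have "inj_on (\<lambda>c. \<Sum>b\<in>B. c b * b) (B \<rightarrow>\<^sub>E K)"
  proof (rule inj_onI)
    fix c e assume ce: "c \<in> B \<rightarrow>\<^sub>E K" "e \<in> B \<rightarrow>\<^sub>E K" "(\<Sum>b\<in>B. c b * b) = (\<Sum>b\<in>B. e b * b)"
    then have "(\<Sum>b\<in>B. (c b - e b) * b) = 0" by (simp add: left_diff_distrib sum_subtractf)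
    moreover have "\<forall>b\<in>B. c b - e b \<in> K" using ce K(3) by auto
    ultimately have "\<forall>b\<in>B. c b - e b = 0"
      using B(1)[unfolded lin_indep_def, THEN conjunct2, THEN spec[of _ "\<lambda>b. c b - e b"]] by simp
    then show "c = e" using ce by (intro PiE_ext[of c B _ e]) auto
  qed
  then have "card (lin_span K B) = card (B \<rightarrow>\<^sub>E K)"
    unfolding lin_span_eq_image[OF fin K(2)] by (rule card_image)
  then show ?thesis using B fin by (simp add: card_PiE)
qed

section \<open>The Frobenius module of a field with \<open>q ^ n\<close> elements\<close>

context
  fixes q n :: nat
  assumes q: "primepow q" and n: "n \<ge> 1" and card: "CARD('a::{field,finite}) = q ^ n"
begin

lemma semilinear_module_Fq: "semilinear_module (Fq q :: 'a set) (\<lambda>x. x ^ q)"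
proof
  have q0: "q > 0" using q by (simp add: primepow_gt_0_nat)
  note add = add_power_primepow[where ?'a = 'a, OF q card]
  show "c + d \<in> Fq q" if "c \<in> Fq q" "d \<in> Fq q" for c d :: 'a
    using that add by (simp add: Fq_def)
  show "- c \<in> Fq q" if "c \<in> Fq q" for c :: 'a
  proof -
    \<comment> \<open>Additivity applied to \<open>c + (- c)\<close> avoids distinguishing even and
      odd \<open>q\<close>.\<close>
    have "c ^ q + (- c) ^ q = 0" using add[of c "- c"] q0 by (simp add: power_0_left)
    then show ?thesis using that by (simp add: Fq_def add_eq_0_iff)
  qed
qed (auto simp: Fq_def power_mult_distrib power_inverse add_power_primepow[where ?'a = 'a, OF q card])

lemma frobenius_power_eq_self: "x ^ (q ^ n) = (x::'a)"
proof (cases "x = 0")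
  case True
  have "q > 0" using q by (simp add: primepow_gt_0_nat)
  then show ?thesis using True by simp
next
  case False
  have "CARD('a) = Suc (CARD('a) - 1)" using finite_UNIV_card_ge_0[where ?'a = 'a] by simp
  then have "x ^ CARD('a) = x * x ^ (CARD('a) - 1)" by (metis power_Suc)
  then show ?thesis using power_card_UNIV_minus_1[OF False] card by simp
qed

interpretation semilinear_module "Fq q :: 'a set" "\<lambda>x. x ^ q"
  by (rule semilinear_module_Fq)

text \<open>The Frobenius map permutes the conjugates cyclically, as \<open>v ^ (q ^ n) = v\<close>,
  so their span is closed under all operators.\<close>

lemma lin_span_conjugates:
  "lin_span (Fq q) {v ^ (q ^ i) | i. i < n} = orbit (v::'a)" (is "lin_span _ ?S = _")
proof (intro equalityI subsetI)
  fix x assume "x \<in> lin_span (Fq q) ?S"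
  then obtain B c where B: "finite B" "B \<subseteq> ?S" "\<forall>b\<in>B. c b \<in> Fq q" "x = (\<Sum>b\<in>B. c b * b)"
    unfolding lin_span_def by blast
  have pow: "v ^ (q ^ i) \<in> orbit v" for i
  proof (induction i)
    case 0
    then show ?case using orbit_self by simp
  next
    case (Suc i)
    then obtain f where f: "f \<in> ops" "v ^ (q ^ i) = f v" by (auto simp: orbit_def)
    have "v ^ (q ^ Suc i) = (v ^ (q ^ i)) ^ q" by (simp add: mult.commute flip: power_mult)
    then show ?case using ops.shift[OF f(1)] f(2) unfolding orbit_def by force
  qed
  show "x \<in> orbit v"
    unfolding B(4) using B(1-3)
  proof (induction B rule: finite_induct)
    case empty
    then show ?case using submod_orbit by (simp add: submod_def)
  next
    case (insert b B)
    have "c b * b \<in> orbit v"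
      using insert.prems pow by (intro submod_scale[OF submod_orbit]) auto
    then show ?case using insert submod_orbit[of v] unfolding submod_def by simp
  qed
next
  have fin: "finite ?S" by simp
  note addS = lin_span_add[OF fin K_0 K_add]
  fix x assume "x \<in> orbit v"
  then obtain f where "f \<in> ops" "x = f v" by (auto simp: orbit_def)
  moreover have "f v \<in> lin_span (Fq q) ?S" if "f \<in> ops" for f
    using that
  proof (induction rule: ops.induct)
    case (scale c)
    have "v \<in> ?S" using n by (intro CollectI exI[of _ 0]) auto
    then show ?case by (rule lin_span_scale_mem[OF scale])
  next
    case (plus f g)
    show ?case by (rule addS[OF _ _ plus.IH])
  next
    case (shift f)
    then obtain B c where B: "finite B" "B \<subseteq> ?S" "\<forall>b\<in>B. c b \<in> Fq q" "f v = (\<Sum>b\<in>B. c b * b)"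
      unfolding lin_span_def by blast
    have "(\<Sum>b\<in>B. c b * b) ^ q \<in> lin_span (Fq q) ?S" using B(1-3)
    proof (induction B rule: finite_induct)
      case empty
      have "v \<in> ?S" using n by (intro CollectI exI[of _ 0]) auto
      moreover have "q > 0" using q by (simp add: primepow_gt_0_nat)
      ultimately show ?case using lin_span_scale_mem[OF K_0, of v ?S] by (simp add: power_0_left)
    next
      case (insert b B)
      then obtain i where i: "i < n" "b = v ^ (q ^ i)" by auto
      have bq: "b ^ q = v ^ (q ^ Suc i)" by (simp add: i mult.commute flip: power_mult)
      have "b ^ q \<in> ?S"
      proof (cases "Suc i < n")
        case True
        then show ?thesis using bq by blast
      next
        case False
        then have "Suc i = n" using i by simp
        then have "b ^ q = v ^ (q ^ 0)" using bq frobenius_power_eq_self[of v] by simp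
        then show ?thesis using n by (intro CollectI exI[of _ 0]) auto
      qed
      then have "c b * b ^ q \<in> lin_span (Fq q) ?S"
        by (rule lin_span_scale_mem[rotated]) (use insert.prems in simp)
      then have "(c b * b) ^ q \<in> lin_span (Fq q) ?S" using insert.prems \<phi>_scale by simp
      then show ?case using insert by (simp add: \<phi>_add addS)
    qed
    then show ?case using B(4) by simp
  qed
  ultimately show "x \<in> lin_span (Fq q) ?S" by simp
qed

lemma k_normal_iff_orbit: "k_normal q n k (v::'a) \<longleftrightarrow> has_dim (Fq q) (orbit v) (n - k)"
  unfolding k_normal_def lin_span_conjugates ..

lemma q_ge_2: "q \<ge> 2"
  using primepow_gt_Suc_0[OF q] by simp

lemma card_orbit_k_normal:
  assumes "k_normal q n k (v::'a)"
  shows "card (orbit v) = q ^ (n - k)"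
proof -
  have "c - d \<in> Fq q" if "c \<in> Fq q" "d \<in> Fq q" for c d :: 'a
    using K_add[OF that(1) K_minus[OF that(2)]] by simp
  then have "card (orbit v) = card (Fq q :: 'a set) ^ (n - k)"
    using assms K_0 by (intro card_has_dim) (auto simp: k_normal_iff_orbit)
  then show ?thesis using card_Fq[OF q_ge_2 card] by simp
qed

text \<open>Being \<open>k\<close>-normal depends on \<open>orbit v\<close> alone, so every
  generator of \<open>orbit \<alpha>\<close> qualifies.\<close>

lemma card_k_normal_ge:
  assumes "k_normal q n k (\<alpha>::'a)"
  shows "(q - 1) ^ (n - k) \<le> card {v::'a. k_normal q n k v}"
proof -
  have K: "card (Fq q :: 'a set) = q" by (rule card_Fq[OF q_ge_2 card])
  have "(q - 1) ^ (n - k) \<le> card {v. orbit v = orbit \<alpha>}"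
    using card_orbit_generators_ge[of \<alpha> "n - k"] card_orbit_k_normal[OF assms] K q_ge_2 by simp
  also have "\<dots> \<le> card {v::'a. k_normal q n k v}"
    using assms by (intro card_mono) (auto simp: k_normal_iff_orbit)
  finally show ?thesis .
qed

lemma k_normal_nonzero:
  assumes "k_normal q n k (v::'a)" "k < n"
  shows "v \<noteq> 0"
proof
  assume "v = 0"
  have "f 0 = 0" if "f \<in> ops" for f using ops_scale[OF that K_0, of 0] by simp
  then have "orbit v \<subseteq> {0}" using \<open>v = 0\<close> by (auto simp: orbit_def)
  then have "card (orbit v) \<le> card {0::'a}" by (rule card_mono[rotated]) simp
  then have "q ^ (n - k) \<le> 1" using card_orbit_k_normal[OF assms(1)] by simp
  moreover have "q ^ (n - k) > 1" using q_ge_2 assms(2) by (intro one_less_power) auto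
  ultimately show False by simp
qed

end

section \<open>Comparing the two counts\<close>

lemma sum_inverse_mult_ord_le:
  "(\<Sum>x\<in>UNIV - {0::'a::{field,finite}}. 1 / real (mult_ord x)) \<le> totient_ratio_sum (CARD('a) - 1)"
proof -
  let ?N = "UNIV - {0::'a}"
  have "card {0, 1::'a} \<le> CARD('a)" by (intro card_mono) auto
  then have pos: "CARD('a) - 1 > 0" by simp
  \<comment> \<open>Elements are grouped by their order \<open>d\<close>, a divisor of the group
    order; each group has at most \<open>totient d\<close> members.\<close>
  have "(\<Sum>x\<in>?N. 1 / real (mult_ord x)) =
      (\<Sum>d | d dvd CARD('a) - 1. \<Sum>x\<in>{x\<in>?N. mult_ord x = d}. 1 / real (mult_ord x))"
    using pos mult_ord_dvd power_card_UNIV_minus_1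
    by (intro sum.group[symmetric]) (auto intro!: finite_divisors_nat)
  also have "\<dots> = (\<Sum>d | d dvd CARD('a) - 1. real (card {x::'a. x \<noteq> 0 \<and> mult_ord x = d}) / real d)"
    by (intro sum.cong) auto
  also have "\<dots> \<le> (\<Sum>d | d dvd CARD('a) - 1. real (totient d) / real d)"
  proof (intro sum_mono divide_right_mono of_nat_mono card_mult_ord_eq_le)
    fix d assume "d \<in> {d. d dvd CARD('a) - 1}"
    then show "d > 0" using dvd_pos_nat[OF pos, of d] by simp
  qed auto
  finally show ?thesis by (simp add: totient_ratio_sum_def)
qed

text \<open>The convex function \<open>4 powr (- s)\<close> meets the line \<open>1 - s\<close> at
  \<open>s = 0\<close> and \<open>s = 1/2\<close>, hence lies below it in between;
  \<open>s = 1 / q\<close> is in that range.\<close>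

lemma four_powr_le:
  assumes "q \<ge> 2"
  shows "real q ^ r * 4 powr (- real r / real q) \<le> (real q - 1) ^ r"
proof -
  define s where "s = 1 / real q"
  have s: "0 \<le> s" "s \<le> 1 / 2" using assms by (auto simp: s_def field_simps)
  have "4 powr (- s) \<le> 1 - s"
  proof -
    have "convex_on UNIV (exp :: real \<Rightarrow> real)" by (rule exp_convex)
    from convex_onD[OF this, of "2 * s" 0 "- ln 2"] s
    have "exp (2 * s * (- ln 2)) \<le> (1 - 2 * s) + 2 * s * exp (- ln 2)" by simp
    moreover have "ln (4::real) = 2 * ln 2" using ln_realpow[of "2::real" 2] by simp
    ultimately show ?thesis by (simp add: powr_def exp_minus algebra_simps)
  qed
  then have "(4 powr (- s)) ^ r \<le> (1 - s) ^ r" by (intro power_mono) auto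
  also have "(4 powr (- s)) ^ r = 4 powr (- real r / real q)" by (simp add: powr_power s_def)
  finally have "real q ^ r * 4 powr (- real r / real q) \<le> real q ^ r * (1 - s) ^ r"
    by (intro mult_left_mono) auto
  also have "\<dots> = (real q - 1) ^ r"
    using assms by (simp add: s_def right_diff_distrib flip: power_mult_distrib)
  finally show ?thesis .
qed

theorem theorem4p1:
  fixes q n k :: nat
  assumes "primepow q"
    and "n \<ge> 2"
    and "k \<le> n - 1"
    and "CARD('a::{field,finite}) = q ^ n"
    and "\<exists>\<alpha>::'a. k_normal q n k \<alpha>"
  shows "\<exists>\<alpha>::'a. k_normal q n k \<alpha> \<and> real (mult_ord \<alpha>) \<ge> tau k q n"
proof (rule ccontr)
  assume contr: "\<not> ?thesis"
  obtain \<alpha>\<^sub>0 :: 'a where \<alpha>\<^sub>0: "k_normal q n k \<alpha>\<^sub>0" using assms(5) by blast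
  have n1: "n \<ge> 1" and kn: "k < n" using assms(2,3) by auto
  have q2: "q \<ge> 2" by (rule q_ge_2[OF assms(1) n1 assms(4)])
  define A where "A = {x::'a. k_normal q n k x}"
  define m where "m = q ^ n - 1"
  define \<delta> where "\<delta> = 1.1 / ln (ln (real m))"
  define \<tau> where "\<tau> = tau k q n"
  have "(2::nat) ^ 2 \<le> q ^ n"
    using q2 assms(2) by (meson le_trans one_le_numeral power_increasing power_mono zero_le)
  then have m3: "m \<ge> 3" and rm: "real m = real q ^ n - 1" by (auto simp: m_def of_nat_diff)
  \<comment> \<open>Hence \<open>\<delta>\<close> is positive, which later allows \<open>m\<close>
    to be enlarged to \<open>q ^ n\<close>.\<close>
  have m1: "ln (real m) > 1"
  proof -
    have "exp 1 < real m" using e_less_272 m3 by linarith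
    then show ?thesis using m3 by (metis exp_gt_zero ln_exp ln_less_cancel_iff order_less_trans)
  qed
  have \<tau>: "\<tau> = 4 powr (- real (n - k) / real q) * real q powr (real (n - k) - real n * \<delta>)"
    using kn by (simp add: \<tau>_def tau_def \<delta>_def rm of_nat_diff algebra_simps)
  have \<tau>0: "\<tau> > 0" unfolding \<tau> using q2 by simp
  have A0: "x \<noteq> 0" if "x \<in> A" for x
    using k_normal_nonzero[OF assms(1) n1 assms(4)] that kn unfolding A_def by blast
  have lt: "real (mult_ord x) < \<tau>" if "x \<in> A" for x
    using contr that unfolding A_def \<tau>_def by force
  have "real (card A) = (\<Sum>x\<in>A. 1)" by simp
  also have "\<dots> < (\<Sum>x\<in>A. \<tau> * (1 / real (mult_ord x)))"
  proof (rule sum_strict_mono)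
    show "A \<noteq> {}" using \<alpha>\<^sub>0 by (auto simp: A_def)
    show "1 < \<tau> * (1 / real (mult_ord x))" if "x \<in> A" for x
      using lt[OF that] mult_ord_pos[OF A0[OF that]] by simp
  qed simp
  also have "\<dots> \<le> (\<Sum>x\<in>UNIV - {0::'a}. \<tau> * (1 / real (mult_ord x)))"
    using A0 \<tau>0 by (intro sum_mono2) auto
  also have "\<dots> \<le> \<tau> * totient_ratio_sum m"
    unfolding sum_distrib_left[symmetric]
    using sum_inverse_mult_ord_le[where ?'a = 'a] \<tau>0 assms(4) by (intro mult_left_mono) (auto simp: m_def)
  also have "\<dots> \<le> \<tau> * real q powr (real n * \<delta>)"
  proof (rule mult_left_mono)
    have "totient_ratio_sum m \<le> real m powr \<delta>"
      unfolding \<delta>_def by (rule totient_ratio_sum_le_powr[OF m3])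
    also have "\<dots> \<le> (real q ^ n) powr \<delta>"
      using m1 rm by (intro powr_mono2) (auto simp: \<delta>_def)
    also have "\<dots> = real q powr (real n * \<delta>)"
      using q2 by (simp add: powr_powr flip: powr_realpow)
    finally show "totient_ratio_sum m \<le> real q powr (real n * \<delta>)" .
  qed (use \<tau>0 in simp)
  \<comment> \<open>The factor \<open>q powr (- n * \<delta>)\<close> inside \<open>\<tau>\<close>
    cancels the bound on the totient sum.\<close>
  also have "\<dots> = real q ^ (n - k) * 4 powr (- real (n - k) / real q)"
    unfolding \<tau> using q2 by (simp add: powr_diff powr_realpow)
  also have "\<dots> \<le> (real q - 1) ^ (n - k)" by (rule four_powr_le[OF q2])
  also have "\<dots> = real ((q - 1) ^ (n - k))" using q2 by (simp add: of_nat_diff)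
  also have "\<dots> \<le> real (card A)"
    using card_k_normal_ge[OF assms(1) n1 assms(4) \<alpha>\<^sub>0] by (simp add: A_def)
  finally show False by simp
qed

end
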